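(* Let $\dot{x} = f(x)$, $x \in \mathbf{C}^n$, with $f$ analytic in a neighbourhood of the origin, be a quasihomogeneous system with weight exponents $g_1,\dots,g_n \in \mathbf{Q}$ and ramification degree $l$. Put $G = \mathrm{diag}(g_1,\dots,g_n)$, let $c \ne 0$ be a solution of $f(c) + Gc = 0$, and let $K = \frac{\partial f}{\partial x}(c) + G$ be the corresponding Kowalevskaya matrix. Assume that $K$ is diagonalizable, and let $\lambda_1,\dots,\lambda_n$ be the Kowalevskaya exponents (the eigenvalues of $K$), numbered so that $\lambda_1 = -1$. Put $\lambda_0 = 1/l$. If the system has a (not identically zero) analytic Lie symmetry of degree $M$ with $M \ge 0$, then for some $j \in \{0,1,\dots,n\}$ the resonance condition $$\sum_{i=1}^{n} k_i \lambda_i = l\,\lambda_j, \qquad k_i \in \mathbf{N}\cup\{0\}, \qquad k_1 \ge M,$$ holds for some $k_1,\dots,k_n$.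
   Context: The system $\dot{x} = f(x)$ is called quasihomogeneous with weight exponents $g_1,\dots,g_n \in \mathbf{Q}$ if it is invariant under $t \mapsto \alpha^{-1}t$, $x^i \mapsto \alpha^{g_i}x^i$ for all real $\alpha > 0$, i.e. $f^i(\alpha^{g_1}x^1,\dots,\alpha^{g_n}x^n) = \alpha^{g_i+1} f^i(x^1,\dots,x^n)$ for $i = 1,\dots,n$. With $G = \mathrm{diag}(g_1,\dots,g_n)$ and $\alpha^G = \mathrm{diag}(\alpha^{g_1},\dots,\alpha^{g_n})$ this reads $f(\alpha^G x) = \alpha^{G+E} f(x)$, where $E$ is the identity matrix. The ramification degree $l$ is the smallest positive integer such that $l g_1,\dots,l g_n$ are all integers. A function $F$ is quasihomogeneous of degree $N$ if $F(\alpha^G x) = \alpha^{N/l}F(x)$. A Lie symmetry of the system is a vector field $X_\phi = \sum_{i=1}^n \phi^i(x)\frac{\partial}{\partial x^i}$ with $[X_f, X_\phi] = X_f X_\phi - X_\phi X_f = 0$, where $X_f = \sum_{i=1}^n f^i(x)\frac{\partial}{\partial x^i}$. It is analytic if all components $\phi^i$ are analytic. A Lie symmetry of degree $M$ means a quasihomogeneous Lie symmetry of degree $M$: for each $i$, $\phi^i$ is a quasihomogeneous function of degree $M + g_i l$. A nonzero solution $c$ of $f(c)+Gc=0$ gives a particular solution $x(t) = t^{-G}c$ of the system; the matrix $K = \frac{\partial f}{\partial x}(c) + G$ is called the Kowalevskaya matrix, and its eigenvalues are called the Kowalevskaya exponents. The number $-1$ is always an eigenvalue of $K$.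
   Formalization: If the weights are not all positive, c is also assumed to be carried by some α^G, α>0, into a connected neighbourhood of the origin on which f and the Lie symmetry are both analytic; with analyticity only near the origin the claim can fail. For positive weights nothing is added. *)

theory Defs
  imports "HOL-Analysis.Analysis"
begin

text \<open>
  Analytic functions of several complex variables: near every point of \<open>U\<close> the function is the sum
  of an (unconditionally, hence absolutely) convergent power series. Multi-indices are functions
  \<open>'n \<Rightarrow> nat\<close>.
\<close>

definition mv_analytic_at :: "(complex ^ 'n \<Rightarrow> complex) \<Rightarrow> complex ^ 'n \<Rightarrow> bool" where
  "mv_analytic_at F a \<longleftrightarrow>
     (\<exists>r>0. \<exists>b :: ('n \<Rightarrow> nat) \<Rightarrow> complex. \<forall>x\<in>ball a r.
        ((\<lambda>k. b k * (\<Prod>i\<in>UNIV. (x $ i - a $ i) ^ k i)) has_sum F x) UNIV)"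

definition mv_analytic_on :: "(complex ^ 'n \<Rightarrow> complex) \<Rightarrow> (complex ^ 'n) set \<Rightarrow> bool" where
  "mv_analytic_on F U \<longleftrightarrow> (\<forall>a\<in>U. mv_analytic_at F a)"

definition analytic_field_on :: "(complex ^ 'n \<Rightarrow> complex ^ 'n) \<Rightarrow> (complex ^ 'n) set \<Rightarrow> bool" where
  "analytic_field_on X U \<longleftrightarrow> (\<forall>i. mv_analytic_on (\<lambda>x. X x $ i) U)"

definition partial :: "'n \<Rightarrow> (complex ^ 'n \<Rightarrow> complex) \<Rightarrow> complex ^ 'n \<Rightarrow> complex" where
  "partial i F x = deriv (\<lambda>t. F (x + t *s axis i 1)) 0"

definition jacobian :: "(complex ^ 'n \<Rightarrow> complex ^ 'n) \<Rightarrow> complex ^ 'n \<Rightarrow> complex ^ 'n ^ 'n" where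
  "jacobian f x = (\<chi> i j. partial j (\<lambda>y. f y $ i) x)"

definition ramification_degree :: "('n::finite \<Rightarrow> rat) \<Rightarrow> nat" where
  "ramification_degree g = (LEAST l. 0 < l \<and> (\<forall>i. of_nat l * g i \<in> \<int>))"

text \<open>The linear map \<open>\<alpha>\<^sup>G\<close>, to be used for real \<open>\<alpha> > 0\<close> only.\<close>

definition wscale :: "('n \<Rightarrow> rat) \<Rightarrow> real \<Rightarrow> complex ^ 'n \<Rightarrow> complex ^ 'n" where
  "wscale g \<alpha> x = (\<chi> i. complex_of_real (\<alpha> powr of_rat (g i)) * x $ i)"

text \<open>
  The smallest set that contains \<open>U\<close> and is invariant under all \<open>\<alpha>\<^sup>G\<close>. A quasihomogeneous function on
  \<open>U\<close> has a unique quasihomogeneous extension to this set, which is the natural domain of the function.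
  If all weights are positive and \<open>U\<close> is a neighbourhood of the origin, it is the whole space.
\<close>

definition saturation :: "('n \<Rightarrow> rat) \<Rightarrow> (complex ^ 'n) set \<Rightarrow> (complex ^ 'n) set" where
  "saturation g U = {x. \<exists>\<alpha>>0. wscale g \<alpha> x \<in> U}"

lemma saturation_UNIV:
  fixes g :: "'n::finite \<Rightarrow> rat"
  assumes "open U" "0 \<in> U" "\<And>i. 0 < g i"
  shows "saturation g U = UNIV"
proof -
  have "\<exists>\<alpha>>0. wscale g \<alpha> x \<in> U" for x
  proof -
    have pow: "((\<lambda>\<alpha>::real. \<alpha> powr of_rat (g i)) \<longlongrightarrow> 0) (at_right 0)" for i
    proof -
      have "((\<lambda>\<alpha>::real. \<alpha> powr of_rat (g i)) \<longlongrightarrow> 0 powr of_rat (g i)) (at_right 0)"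
        by (rule tendsto_powr') (use assms(3)[of i] in \<open>auto intro!: tendsto_intros eventually_at_rightI[of 0 1]\<close>)
      then show ?thesis by simp
    qed
    have "((\<lambda>\<alpha>. wscale g \<alpha> x) \<longlongrightarrow> 0) (at_right 0)"
    proof (rule vec_tendstoI)
      fix i
      have "((\<lambda>\<alpha>. complex_of_real (\<alpha> powr of_rat (g i)) * x $ i) \<longlongrightarrow> complex_of_real 0 * x $ i) (at_right 0)"
        by (intro tendsto_intros pow)
      then show "((\<lambda>\<alpha>. wscale g \<alpha> x $ i) \<longlongrightarrow> 0 $ i) (at_right 0)"
        by (simp add: wscale_def)
    qed
    then have "eventually (\<lambda>\<alpha>. wscale g \<alpha> x \<in> U) (at_right 0)"
      using assms(1,2) by (rule topological_tendstoD)
    moreover have "eventually (\<lambda>\<alpha>::real. 0 < \<alpha>) (at_right 0)"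
      by (rule eventually_at_right_less)
    ultimately have "eventually (\<lambda>\<alpha>. 0 < \<alpha> \<and> wscale g \<alpha> x \<in> U) (at_right 0)"
      by eventually_elim simp
    then show ?thesis
      by (auto dest: eventually_happens)
  qed
  then show ?thesis by (auto simp: saturation_def)
qed

text \<open>\<open>F (\<alpha>\<^sup>G x) = \<alpha>\<^sup>N\<^sup>/\<^sup>l F x\<close>, where \<open>l\<close> is the ramification degree.\<close>

definition quasihomogeneous_fun ::
    "('n::finite \<Rightarrow> rat) \<Rightarrow> (complex ^ 'n) set \<Rightarrow> real \<Rightarrow> (complex ^ 'n \<Rightarrow> complex) \<Rightarrow> bool" where
  "quasihomogeneous_fun g D N F \<longleftrightarrow>
     (\<forall>\<alpha>>0. \<forall>x\<in>D. F (wscale g \<alpha> x)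
        = complex_of_real (\<alpha> powr (N / real (ramification_degree g))) * F x)"

definition quasihomogeneous_system ::
    "('n \<Rightarrow> rat) \<Rightarrow> (complex ^ 'n) set \<Rightarrow> (complex ^ 'n \<Rightarrow> complex ^ 'n) \<Rightarrow> bool" where
  "quasihomogeneous_system g D f \<longleftrightarrow>
     (\<forall>\<alpha>>0. \<forall>x\<in>D. \<forall>i. f (wscale g \<alpha> x) $ i = complex_of_real (\<alpha> powr (of_rat (g i) + 1)) * f x $ i)"

text \<open>The vector field \<open>X\<close>, acting on functions as a differential operator.\<close>

definition vf_apply ::
    "(complex ^ 'n \<Rightarrow> complex ^ 'n) \<Rightarrow> (complex ^ 'n \<Rightarrow> complex) \<Rightarrow> complex ^ 'n \<Rightarrow> complex" where
  "vf_apply X F x = (\<Sum>i\<in>UNIV. X x $ i * partial i F x)"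

definition lie_symmetry ::
    "(complex ^ 'n) set \<Rightarrow> (complex ^ 'n \<Rightarrow> complex ^ 'n) \<Rightarrow> (complex ^ 'n \<Rightarrow> complex ^ 'n) \<Rightarrow> bool" where
  "lie_symmetry U f \<phi> \<longleftrightarrow>
     (\<forall>F. mv_analytic_on F U \<longrightarrow>
        (\<forall>x\<in>U. vf_apply f (vf_apply \<phi> F) x - vf_apply \<phi> (vf_apply f F) x = 0))"

definition lie_symmetry_of_degree ::
    "('n::finite \<Rightarrow> rat) \<Rightarrow> (complex ^ 'n) set \<Rightarrow> (complex ^ 'n \<Rightarrow> complex ^ 'n) \<Rightarrow> real
      \<Rightarrow> (complex ^ 'n \<Rightarrow> complex ^ 'n) \<Rightarrow> bool" where
  "lie_symmetry_of_degree g U f M \<phi> \<longleftrightarrow>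
     lie_symmetry U f \<phi> \<and>
     (\<forall>i. quasihomogeneous_fun g (saturation g U)
            (M + of_rat (g i) * real (ramification_degree g)) (\<lambda>x. \<phi> x $ i))"

definition diag_mat :: "('n \<Rightarrow> complex) \<Rightarrow> complex ^ 'n ^ 'n" where
  "diag_mat d = (\<chi> i j. if i = j then d i else 0)"

definition weight_matrix :: "('n \<Rightarrow> rat) \<Rightarrow> complex ^ 'n ^ 'n" where
  "weight_matrix g = diag_mat (\<lambda>i. of_rat (g i))"

definition kowalevskaya_matrix ::
    "('n \<Rightarrow> rat) \<Rightarrow> (complex ^ 'n \<Rightarrow> complex ^ 'n) \<Rightarrow> complex ^ 'n \<Rightarrow> complex ^ 'n ^ 'n" where
  "kowalevskaya_matrix g f c = jacobian f c + weight_matrix g"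

definition diagonalizable :: "complex ^ 'n ^ 'n \<Rightarrow> bool" where
  "diagonalizable A \<longleftrightarrow> (\<exists>(P :: complex ^ 'n ^ 'n) d. invertible P \<and> A = P ** diag_mat d ** matrix_inv P)"

text \<open>\<open>lam\<close> lists the eigenvalues of \<open>A\<close> with multiplicity, i.e. the roots of its characteristic
  polynomial.\<close>

definition eigenvalues_of :: "complex ^ 'n ^ 'n \<Rightarrow> ('n \<Rightarrow> complex) \<Rightarrow> bool" where
  "eigenvalues_of A lam \<longleftrightarrow> (\<forall>z. det (mat z - A) = (\<Prod>i\<in>UNIV. (z - lam i)))"

end

(* Quasihomogeneity of degree M says that the bracket of the Euler field G x with X_phi is (M / l) X_phi.
   Hence, with h = f + G x, one has [X_h, X_phi] = (M / l) X_phi, and h vanishes at c with Jacobian K.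
   The lowest-order homogeneous part of phi at c is then an eigenvector, with eigenvalue M / l, of the
   bracket with the linear field K (x - c). In eigencoordinates that bracket is diagonal on monomial
   fields, so sum k_i lambda_i - lambda_j = M / l for some k and j. The same argument at the origin with
   the linear field G x shows that M is an integer; multiplying by l and moving M to the eigenvalue -1
   gives the resonance, and the case j = 0 is never needed. Since c may lie outside U, the computation
   takes place at the rescaled point beta^G c in U, where all exponents are multiplied by beta. *)

theory Submission
  imports Defs "HOL-Complex_Analysis.Cauchy_Integral_Formula"
begin

subsection \<open>Power series in several variables\<close>

text \<open>Taylor expansions are replaced by words of directional derivatives at a point. Power
  series serve only to establish complex differentiability, commuting partial derivatives, closure
  properties and the identity theorem. The gain is that a derivative along an eigenvector of the
  matrix of a linear field passes through that field at the cost of a scalar, so homogeneous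
  polynomials are never formed: for a fixed word of eigendirections the derivatives of the
  components of \<phi> make up one vector, and this vector is an eigenvector of the Jacobian.
  Diagonalizability supplies enough eigendirections to detect the lowest nonzero derivative, and
  connectedness of \<open>U\<close> guarantees that there is one. Integrality of \<open>M\<close>
  matters because \<open>M\<close> is absorbed, as a natural number, into the multiplicity of the
  eigenvalue -1.\<close>

definition vpow :: "complex ^ 'n \<Rightarrow> ('n \<Rightarrow> nat) \<Rightarrow> complex" where
  "vpow z k = (\<Prod>i\<in>UNIV. (z $ i) ^ k i)"

text \<open>Exposes the radius and the coefficients that \<open>mv_analytic_at\<close> hides behind
  quantifiers, so that coefficients can be followed through differentiation and
  multiplication.\<close>

definition mv_expansion ::
    "(complex ^ 'n \<Rightarrow> complex) \<Rightarrow> complex ^ 'n \<Rightarrow> real \<Rightarrow> (('n \<Rightarrow> nat) \<Rightarrow> complex) \<Rightarrow> bool" where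
  "mv_expansion F a r b \<longleftrightarrow> (\<forall>x\<in>ball a r. ((\<lambda>k. b k * vpow (x - a) k) has_sum F x) UNIV)"

lemma mv_analytic_at_iff: "mv_analytic_at F a \<longleftrightarrow> (\<exists>r>0. \<exists>b. mv_expansion F a r b)"
  by (simp add: mv_analytic_at_def mv_expansion_def vpow_def)

lemma norm_axis: "norm (axis i t :: complex ^ 'n) = norm t"
proof -
  have "(\<Sum>j\<in>UNIV. (norm ((axis i t :: complex ^ 'n) $ j))\<^sup>2) = (\<Sum>j\<in>UNIV. if j = i then (norm t)\<^sup>2 else 0)"
    by (intro sum.cong) (auto simp: axis_def)
  then show ?thesis by (simp add: norm_vec_def L2_set_def)
qed

lemma vpow_mono:
  assumes "\<And>i. norm (z $ i) \<le> norm (w $ i)"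
  shows "norm (vpow z k) \<le> norm (vpow w k)"
  unfolding vpow_def prod_norm[symmetric]
  by (intro prod_mono) (auto simp: norm_power intro!: power_mono assms)

lemma vpow_zero: "vpow 0 k = (if k = (\<lambda>_. 0) then 1 else 0)"
proof (cases "k = (\<lambda>_. 0)")
  case False
  then obtain i where "k i \<noteq> 0" by auto
  then show ?thesis
    using False by (auto simp: vpow_def intro!: prod_zero bexI[of _ i])
qed (simp add: vpow_def)

lemma vpow_add: "vpow z (\<lambda>i. p i + q i) = vpow z p * vpow z q"
  by (simp add: vpow_def power_add prod.distrib)

lemma vpow_remove: "vpow z k = (z $ i) ^ k i * (\<Prod>j\<in>UNIV - {i}. (z $ j) ^ k j)"
  unfolding vpow_def by (subst prod.remove[of _ i]) auto

lemma vpow_axis_line: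
  "vpow (z + t *s axis i 1) k = (z $ i + t) ^ k i * (\<Prod>j\<in>UNIV - {i}. (z $ j) ^ k j)"
  unfolding vpow_remove[of _ _ i] by (auto simp: axis_def intro!: prod.cong)

lemma mv_expansion_mono: "mv_expansion F a r b \<Longrightarrow> s \<le> r \<Longrightarrow> mv_expansion F a s b"
  by (auto simp: mv_expansion_def)

lemma mv_expansion_center:
  assumes "mv_expansion F a r b" "r > 0"
  shows "F a = b (\<lambda>_. 0)"
proof -
  have "((\<lambda>k. b k * vpow 0 k) has_sum F a) UNIV"
    using assms by (auto simp: mv_expansion_def dest: bspec[of _ _ a])
  moreover have "((\<lambda>k. b k * vpow 0 k) has_sum b (\<lambda>_. 0)) UNIV"
    by (rule has_sum_finite_neutralI[of "{\<lambda>_. 0}"]) (auto simp: vpow_zero)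
  ultimately show ?thesis by (rule has_sum_unique)
qed

lemma mv_expansion_abs_summable:
  assumes "mv_expansion F a r b" "norm z < r"
  shows "(\<lambda>k. norm (b k * vpow z k)) summable_on UNIV"
proof -
  have "((\<lambda>k. b k * vpow z k) has_sum F (a + z)) UNIV"
    using assms by (auto simp: mv_expansion_def dist_norm dest: bspec[of _ _ "a + z"])
  then show ?thesis
    by (metis has_sum_imp_summable summable_on_iff_abs_summable_on_complex)
qed

text \<open>Along a complex line in direction \<open>i\<close> the finite partial sums are
  polynomials in \<open>t\<close> that converge uniformly on a small disc, so derivatives pass to
  the limit by the Weierstrass theorem. The limit is taken along the finite sets of
  multi-indices.\<close>

lemma mv_expansion_partial:
  fixes F :: "complex ^ 'n \<Rightarrow> complex"
  assumes F: "mv_expansion F a r b"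
  shows "mv_expansion (partial i F) a r (\<lambda>k. of_nat (k i + 1) * b (k(i := k i + 1)))"
  unfolding mv_expansion_def
proof
  fix x assume x: "x \<in> ball a r"
  define z where "z = x - a"
  define \<epsilon> where "\<epsilon> = (r - norm z) / 2"
  have nz: "norm z < r" using x by (simp add: z_def dist_norm norm_minus_commute)
  then have \<epsilon>: "\<epsilon> > 0" "norm z + \<epsilon> < r" by (auto simp: \<epsilon>_def field_simps)
  \<comment> \<open>\<open>u\<close> collects the moduli of the coordinates of \<open>z\<close>, and
    \<open>w\<close> enlarges coordinate \<open>i\<close> by \<epsilon>. It dominates every point of
    the disc coordinatewise and still has norm below \<open>r\<close>, so the series at
    \<open>w\<close> is the majorant.\<close>
  define u :: "complex ^ 'n" where "u = (\<chi> j. of_real (norm (z $ j)))"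
  define w where "w = u + of_real \<epsilon> *s axis i 1"
  have "norm u = norm z" by (simp add: norm_vec_def u_def)
  moreover have "norm (of_real \<epsilon> *s axis i 1 :: complex ^ 'n) = \<epsilon>"
  proof -
    have "of_real \<epsilon> *s axis i 1 = (axis i (of_real \<epsilon>) :: complex ^ 'n)"
      by (simp add: vec_eq_iff axis_def)
    then show ?thesis using \<epsilon> by (simp add: norm_axis)
  qed
  ultimately have w: "norm w < r"
    using norm_triangle_ineq[of u "of_real \<epsilon> *s axis i 1"] \<epsilon> unfolding w_def by linarith
  have line: "norm (z + t *s axis i 1) < r" if "t \<in> ball 0 \<epsilon>" for t
  proof -
    have "t *s axis i 1 = (axis i t :: complex ^ 'n)"
      by (simp add: vec_eq_iff axis_def)
    then have "norm (z + t *s axis i 1) \<le> norm z + norm t"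
      using norm_triangle_ineq[of z "axis i t"] by (simp add: norm_axis)
    also have "\<dots> < r" using that \<epsilon> by simp
    finally show ?thesis .
  qed
  have comp: "norm ((z + t *s axis i 1) $ j) \<le> norm (w $ j)" if "t \<in> ball 0 \<epsilon>" for t j
  proof (cases "j = i")
    case True
    have "norm (w $ i) = norm (z $ i) + \<epsilon>"
      using \<epsilon> by (simp add: w_def u_def flip: of_real_add)
    then show ?thesis
      using True that norm_triangle_ineq[of "z $ i" t] by simp
  qed (simp add: w_def u_def axis_def)
  have lim: "uniform_limit (ball 0 \<epsilon>) (\<lambda>X t. \<Sum>k\<in>X. b k * vpow (z + t *s axis i 1) k)
      (\<lambda>t. F (x + t *s axis i 1)) (finite_subsets_at_top UNIV)"
  proof (rule Weierstrass_m_test_general'[where M = "\<lambda>k. norm (b k * vpow w k)"])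
    show "norm (b k * vpow (z + t *s axis i 1) k) \<le> norm (b k * vpow w k)"
      if "t \<in> ball 0 \<epsilon>" for k t
      using vpow_mono[OF comp[OF that]] by (simp add: norm_mult mult_left_mono)
    show "((\<lambda>k. b k * vpow (z + t *s axis i 1) k) has_sum F (x + t *s axis i 1)) UNIV"
      if "t \<in> ball 0 \<epsilon>" for t
    proof -
      let ?y = "x + t *s axis i 1"
      have "?y \<in> ball a r"
        using line[OF that] by (simp add: z_def dist_norm norm_minus_commute algebra_simps)
      then have "((\<lambda>k. b k * vpow (?y - a) k) has_sum F ?y) UNIV"
        using F unfolding mv_expansion_def by blast
      moreover have "?y - a = z + t *s axis i 1" by (simp add: z_def)
      ultimately show ?thesis by simp
    qed
    show "(\<lambda>k. norm (b k * vpow w k)) summable_on UNIV"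
      using F w by (rule mv_expansion_abs_summable)
  qed
  let ?p = "\<lambda>k. \<Prod>j\<in>UNIV - {i}. (z $ j) ^ k j"
  let ?g = "\<lambda>k. b k * (of_nat (k i) * (z $ i) ^ (k i - 1) * ?p k)"
  have der: "((\<lambda>t. \<Sum>k\<in>X. b k * vpow (z + t *s axis i 1) k) has_field_derivative (\<Sum>k\<in>X. ?g k)) (at 0)" for X
    unfolding vpow_axis_line
    by (rule DERIV_sum) (auto intro!: derivative_eq_intros)
  have "((\<lambda>X. (deriv ^^ 1) (\<lambda>t. \<Sum>k\<in>X. b k * vpow (z + t *s axis i 1) k) 0) \<longlongrightarrow>
      (deriv ^^ 1) (\<lambda>t. F (x + t *s axis i 1)) 0) (finite_subsets_at_top UNIV)"
    by (rule higher_deriv_complex_uniform_limit[OF lim])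
       (auto simp: \<epsilon> vpow_axis_line intro!: always_eventually holomorphic_intros)
  then have "(?g has_sum partial i F x) UNIV"
    unfolding has_sum_def partial_def using DERIV_imp_deriv[OF der] by simp
  \<comment> \<open>Terms with \<open>k i = 0\<close> have derivative zero. Dropping them leaves the
    multi-indices raised at \<open>i\<close>, and reindexing shifts the coefficients.\<close>
  then have "(?g has_sum partial i F x) (range (\<lambda>k :: 'n \<Rightarrow> nat. k(i := k i + 1)))"
  proof (rule has_sum_cong_neutral[THEN iffD1, rotated -1])
    fix k :: "'n \<Rightarrow> nat" assume k: "k \<in> UNIV - range (\<lambda>k. k(i := k i + 1))"
    have "k i = 0"
    proof (rule ccontr)
      assume "k i \<noteq> 0"
      then have "k = (k(i := k i - 1))(i := (k(i := k i - 1)) i + 1)"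
        by (auto simp: fun_eq_iff)
      then show False using k by blast
    qed
    then show "?g k = 0" by simp
  qed auto
  moreover have "inj (\<lambda>k :: 'n \<Rightarrow> nat. k(i := k i + 1))"
    by (rule injI) (auto simp: fun_eq_iff split: if_splits)
  ultimately have "((?g \<circ> (\<lambda>k. k(i := k i + 1))) has_sum partial i F x) UNIV"
    by (simp add: has_sum_reindex)
  moreover have "?g (k(i := k i + 1)) = of_nat (k i + 1) * b (k(i := k i + 1)) * vpow z k" for k
    unfolding vpow_remove[of z k i] by (auto intro!: prod.cong)
  ultimately show "((\<lambda>k. of_nat (k i + 1) * b (k(i := k i + 1)) * vpow (x - a) k) has_sum partial i F x) UNIV"
    by (simp only: o_def z_def)
qed

text \<open>Cauchy product: absolute convergence lets the double sum be regrouped by the sum of the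
  two multi-indices. Their order is pointwise, so \<open>{..k}\<close> is finite and the subtraction
  \<open>k i - p i\<close> is never truncated.\<close>

lemma mv_expansion_mult:
  fixes F H :: "complex ^ 'n \<Rightarrow> complex"
  assumes F: "mv_expansion F a r b" and H: "mv_expansion H a r c"
  shows "mv_expansion (\<lambda>x. F x * H x) a r (\<lambda>k. \<Sum>p\<in>{..k}. b p * c (\<lambda>i. k i - p i))"
  unfolding mv_expansion_def
proof
  fix x assume x: "x \<in> ball a r"
  let ?z = "x - a"
  have nz: "norm ?z < r" using x by (simp add: dist_norm norm_minus_commute)
  let ?f = "\<lambda>k. b k * vpow ?z k" and ?h = "\<lambda>k. c k * vpow ?z k"
  have sf: "(\<lambda>k. norm (?f k)) summable_on UNIV"
    and sh: "(\<lambda>k. norm (?h k)) summable_on UNIV"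
    using mv_expansion_abs_summable[OF F nz] mv_expansion_abs_summable[OF H nz] by auto
  let ?P = "\<lambda>(p, q). ?f p * ?h q"
  have "(\<lambda>x. norm (?P x)) summable_on UNIV \<times> UNIV"
    unfolding Infinite_Sum.abs_summable_on_Sigma_iff using sf sh
    by (auto simp: norm_mult abs_mult infsum_cmult_right' simp del: UNIV_Times_UNIV intro!: summable_on_cmult_right summable_on_cmult_left)
  then have "?P summable_on UNIV \<times> UNIV"
    by (rule abs_summable_summable)
  moreover have "(?f has_sum F x) UNIV" "(?h has_sum H x) UNIV"
    using F H x by (auto simp: mv_expansion_def)
  ultimately have "((\<lambda>(p, q). ?f p * ?h q) has_sum F x * H x) (UNIV \<times> UNIV)"
    by (intro has_sum_SigmaI[where g = "\<lambda>p. ?f p * H x"])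
       (auto intro: has_sum_cmult_right has_sum_cmult_left)
  also have "?this \<longleftrightarrow> ((\<lambda>(k, p). b p * c (\<lambda>i. k i - p i) * vpow ?z k) has_sum F x * H x)
      (Sigma UNIV (\<lambda>k. {..k}))"
    by (rule has_sum_reindex_bij_witness[of _ "\<lambda>(k, p). (p, \<lambda>i. k i - p i)" "\<lambda>(p, q). (\<lambda>i. p i + q i, p)"])
       (auto simp: le_fun_def vpow_add)
  finally show "((\<lambda>k. (\<Sum>p\<in>{..k}. b p * c (\<lambda>i. k i - p i)) * vpow (x - a) k) has_sum F x * H x) UNIV"
  proof (rule has_sum_SigmaD)
    fix k :: "'n \<Rightarrow> nat"
    have "finite {..k}"
      by (rule finite_subset[of _ "Pi\<^sub>E UNIV (\<lambda>i. {..k i})"]) (auto simp: le_fun_def finite_PiE)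
    then show "((\<lambda>p. case (k, p) of (k, p) \<Rightarrow> b p * c (\<lambda>i. k i - p i) * vpow ?z k) has_sum
        (\<Sum>p\<in>{..k}. b p * c (\<lambda>i. k i - p i)) * vpow (x - a) k) {..k}"
      by (auto intro!: has_sum_finiteI simp: sum_distrib_right)
  qed
qed


text \<open>For small increments the terms of total degree at least two add up to at most a constant
  times the squared norm.\<close>

lemma mv_expansion_has_derivative:
  fixes F :: "complex ^ 'n \<Rightarrow> complex"
  assumes F: "mv_expansion F a r b" and r: "r > 0"
  shows "(F has_derivative (\<lambda>v. \<Sum>i\<in>UNIV. v $ i * b ((\<lambda>_. 0)(i := 1)))) (at a)"
proof -
  let ?e = "\<lambda>i. (\<lambda>_. 0)(i := 1) :: 'n \<Rightarrow> nat"
  let ?D = "\<lambda>v. \<Sum>i\<in>UNIV. v $ i * b (?e i)"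
  \<comment> \<open>The multi-indices of total degree at most one.\<close>
  define N where "N = insert (\<lambda>_. 0) (range ?e)"
  have "finite N" by (simp add: N_def)
  have vpow_e: "vpow z (?e i) = z $ i" for z :: "complex ^ 'n" and i
    unfolding vpow_remove[of z _ i] by simp
  have inj: "inj ?e"
    by (rule injI) (auto simp: fun_eq_iff split: if_splits dest: spec)
  have order2: "2 \<le> sum k UNIV" if "k \<notin> N" for k
  proof (rule ccontr)
    assume "\<not> 2 \<le> sum k UNIV"
    then consider "sum k UNIV = 0" | "sum k UNIV = 1" by linarith
    then show False
    proof cases
      case 1
      then have "k = (\<lambda>_. 0)" by auto
      with that show False by (simp add: N_def)
    next
      case 2
      then obtain i where i: "k i = 1" "\<And>j. j \<noteq> i \<Longrightarrow> k j = 0"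
        by (auto simp: sum_eq_Suc0_iff)
      then have "k = ?e i" by (auto simp: fun_eq_iff)
      with that show False by (auto simp: N_def)
    qed
  qed
  \<comment> \<open>Small enough that the vector with all coordinates \<open>s\<close> has norm at
    most \<open>r / 2\<close>; the series at this vector is the majorant.\<close>
  define s where "s = r / (2 * real CARD('n))"
  define w :: "complex ^ 'n" where "w = (\<chi> i. of_real s)"
  have s: "s > 0" using r by (simp add: s_def)
  have "norm w \<le> (\<Sum>i\<in>UNIV. norm (w $ i))"
    by (simp add: norm_vec_def L2_set_le_sum)
  also have "\<dots> = real CARD('n) * s" using s by (simp add: w_def)
  also have "\<dots> = r / 2" by (simp add: s_def)
  finally have w: "norm w < r" using r by linarith
  define C where "C = (\<Sum>\<^sub>\<infinity>k. norm (b k * vpow w k))"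
  have summ: "(\<lambda>k. norm (b k * vpow w k)) summable_on UNIV"
    by (rule mv_expansion_abs_summable[OF F w])
  have est: "norm (F (a + v) - F a - ?D v) \<le> (norm v / s)\<^sup>2 * C" if v: "norm v \<le> s" "norm v < r" for v
  proof -
    have sN: "(\<Sum>k\<in>N. b k * vpow v k) = F a + ?D v"
    proof -
      have "(\<lambda>_. 0) \<noteq> ?e i" for i
      proof
        assume "(\<lambda>_. 0) = ?e i"
        then have "0 = ?e i i" by metis
        then show False by simp
      qed
      then have "(\<lambda>_. 0) \<notin> range ?e" by auto
      then have "(\<Sum>k\<in>N. b k * vpow v k) = b (\<lambda>_. 0) * vpow v (\<lambda>_. 0) + (\<Sum>k\<in>range ?e. b k * vpow v k)"
        unfolding N_def by simp
      also have "(\<Sum>k\<in>range ?e. b k * vpow v k) = ?D v"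
        by (subst sum.reindex[OF inj]) (simp add: vpow_e mult.commute del: One_nat_def)
      finally show ?thesis
        by (simp add: vpow_def mv_expansion_center[OF F r])
    qed
    have "((\<lambda>k. b k * vpow v k) has_sum F (a + v)) UNIV"
      using F v unfolding mv_expansion_def by (auto dest!: bspec[of _ _ "a + v"] simp: dist_norm)
    then have "((\<lambda>k. b k * vpow v k) has_sum (F (a + v) - (F a + ?D v))) (UNIV - N)"
      using \<open>finite N\<close> sN by (intro has_sum_Diff[OF _ has_sum_finiteI]) auto
    moreover have "((\<lambda>k. (norm v / s)\<^sup>2 * norm (b k * vpow w k)) has_sum
        ((norm v / s)\<^sup>2 * (\<Sum>\<^sub>\<infinity>k\<in>UNIV - N. norm (b k * vpow w k)))) (UNIV - N)"
      by (intro has_sum_cmult_right has_sum_infsum summable_on_subset_banach[OF summ]) auto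
    ultimately have "norm (F (a + v) - (F a + ?D v)) \<le>
        (norm v / s)\<^sup>2 * (\<Sum>\<^sub>\<infinity>k\<in>UNIV - N. norm (b k * vpow w k))"
    proof (rule norm_infsum_le)
      fix k assume "k \<in> UNIV - N"
      then have k: "2 \<le> sum k UNIV" by (auto intro: order2)
      let ?q = "norm v / s"
      \<comment> \<open>Monomials are homogeneous: scaling by \<open>q\<close> produces
        \<open>q\<close> to the total degree, which for \<open>q\<close> at most 1 and degree at
        least two is bounded by the square of \<open>q\<close>.\<close>
      have scale: "(\<Prod>i\<in>UNIV. (q * s) ^ k i) = q ^ sum k UNIV * norm (vpow w k)" for q :: real
        using s by (simp add: power_mult_distrib prod.distrib power_sum vpow_def w_def
          prod_norm[symmetric] norm_power)
      have q: "0 \<le> ?q" "?q \<le> 1" using v s by auto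
      have "norm (vpow v k) \<le> (\<Prod>i\<in>UNIV. (?q * s) ^ k i)"
        unfolding vpow_def prod_norm[symmetric] using s
        by (intro prod_mono) (auto simp: norm_power Finite_Cartesian_Product.norm_nth_le intro!: power_mono)
      also have "\<dots> = ?q ^ sum k UNIV * norm (vpow w k)"
        by (rule scale)
      also have "\<dots> \<le> ?q ^ 2 * norm (vpow w k)"
        by (intro mult_right_mono power_decreasing k q) auto
      finally show "norm (b k * vpow v k) \<le> ?q\<^sup>2 * norm (b k * vpow w k)"
        by (simp add: norm_mult mult.left_commute mult_left_mono)
    qed
    also have "\<dots> \<le> (norm v / s)\<^sup>2 * C"
      unfolding C_def
      by (intro mult_left_mono infsum_mono_neutral summ summable_on_subset_banach[OF summ]) auto
    finally show ?thesis by (simp add: algebra_simps)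
  qed
  show ?thesis
  proof (rule has_derivativeI_sandwich[where e = "min s r" and H = "\<lambda>y. norm (y - a) * (C / s\<^sup>2)"])
    show "bounded_linear ?D"
      by (intro bounded_linear_sum bounded_linear_compose[OF bounded_linear_mult_left bounded_linear_vec_nth])
    show "((\<lambda>y. norm (y - a) * (C / s\<^sup>2)) \<longlongrightarrow> 0) (at a)"
      using s by (auto intro!: tendsto_eq_intros)
    fix y assume "y \<noteq> a" "dist y a < min s r"
    then have "norm (F (a + (y - a)) - F a - ?D (y - a)) / norm (y - a) \<le> (norm (y - a) / s)\<^sup>2 * C / norm (y - a)"
      by (intro divide_right_mono est) (auto simp: dist_norm)
    then show "norm (F y - F a - ?D (y - a)) / norm (y - a) \<le> norm (y - a) * (C / s\<^sup>2)"
      using \<open>y \<noteq> a\<close> by (simp add: power2_eq_square field_simps)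
  qed (use s r in auto)
qed

subsection \<open>Directional derivatives\<close>

text \<open>Built from partial derivatives rather than from a limit along \<open>v\<close>, which
  makes it linear in \<open>v\<close> for arbitrary functions. As an operator on functions it can be
  iterated with \<open>fold\<close>.\<close>

definition dird :: "complex ^ 'n \<Rightarrow> (complex ^ 'n \<Rightarrow> complex) \<Rightarrow> complex ^ 'n \<Rightarrow> complex" where
  "dird v = vf_apply (\<lambda>_. v)"

lemma dird_eq: "dird v F x = (\<Sum>i\<in>UNIV. v $ i * partial i F x)"
  by (simp add: dird_def vf_apply_def)

lemma vf_apply_eq_dird: "vf_apply X F x = dird (X x) F x"
  by (simp add: dird_eq vf_apply_def)

lemma dird_axis: "dird (axis i 1) F = partial i F"
proof
  fix x
  have "dird (axis i 1) F x = (\<Sum>j\<in>UNIV. if j = i then partial j F x else 0)"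
    unfolding dird_eq by (intro sum.cong) (auto simp: axis_def)
  then show "dird (axis i 1) F x = partial i F x" by simp
qed

lemma dird_vec_add: "dird (u + v) F x = dird u F x + dird v F x"
  by (simp add: dird_eq distrib_right sum.distrib)

lemma dird_vec_scale: "dird (t *s v) F x = t * dird v F x"
  by (simp add: dird_eq sum_distrib_left mult.assoc)

lemma dird_vec_zero: "dird 0 F x = 0"
  by (simp add: dird_eq)

lemma dird_vec_sum: "dird (\<Sum>j\<in>J. v j) F x = (\<Sum>j\<in>J. dird (v j) F x)"
  by (induction J rule: infinite_finite_induct) (auto simp: dird_vec_add dird_vec_zero)

text \<open>The derivative in the premise is complex linear, so restricting to a complex line yields
  a complex derivative in the sense of \<open>deriv\<close>.\<close>

lemma has_derivative_imp_partial:
  assumes "(F has_derivative (\<lambda>v. \<Sum>i\<in>UNIV. v $ i * p i)) (at x)"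
  shows "partial i F x = p i"
proof -
  have "((\<lambda>t. x + t *s axis i 1) has_derivative (\<lambda>t. t *s axis i 1)) (at (0 :: complex))"
  proof -
    have "(\<lambda>t. t *s axis i 1) = (\<lambda>t. axis i t :: complex ^ 'a)"
      by (auto simp: vec_eq_iff axis_def)
    moreover have "bounded_linear (\<lambda>t. axis i t :: complex ^ 'a)"
      by (rule bounded_linear_intro[where K = 1]) (auto simp: vec_eq_iff axis_def norm_axis[unfolded axis_def])
    ultimately have "((\<lambda>t. t *s axis i 1 :: complex ^ 'a) has_derivative (\<lambda>t. t *s axis i 1)) (at 0)"
      using bounded_linear_imp_has_derivative by metis
    then show ?thesis by (auto intro!: derivative_eq_intros)
  qed
  then have "(F \<circ> (\<lambda>t. x + t *s axis i 1) has_derivative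
      (\<lambda>v. \<Sum>i\<in>UNIV. v $ i * p i) \<circ> (\<lambda>t. t *s axis i 1)) (at (0 :: complex))"
    by (rule diff_chain_at) (use assms in simp)
  moreover have "(\<Sum>j\<in>UNIV. (t *s axis i 1) $ j * p j) = p i * t" for t
  proof -
    have "(\<Sum>j\<in>UNIV. (t *s axis i 1) $ j * p j) = (\<Sum>j\<in>UNIV. if j = i then p i * t else 0)"
      by (intro sum.cong) (auto simp: axis_def)
    then show ?thesis by simp
  qed
  ultimately have "((\<lambda>t. F (x + t *s axis i 1)) has_field_derivative p i) (at 0)"
    by (simp add: has_field_derivative_def o_def)
  then show ?thesis unfolding partial_def by (rule DERIV_imp_deriv)
qed

text \<open>Source of the calculus rules below: a rule for \<open>has_derivative\<close> becomes a
  rule for \<open>dird\<close> once its derivative is written in this form.\<close>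

lemma has_derivative_imp_dird:
  assumes "(F has_derivative (\<lambda>v. \<Sum>i\<in>UNIV. v $ i * p i)) (at x)"
  shows "dird v F x = (\<Sum>i\<in>UNIV. v $ i * p i)"
  by (simp add: dird_eq has_derivative_imp_partial[OF assms])

section \<open>Closure properties of analytic functions\<close>

lemma mv_analytic_onE:
  assumes "mv_analytic_on F U" "a \<in> U"
  obtains r b where "r > 0" "mv_expansion F a r b"
  using assms by (auto simp: mv_analytic_on_def mv_analytic_at_iff)

lemma mv_analytic_onI:
  assumes "\<And>a. a \<in> U \<Longrightarrow> \<exists>r>0. \<exists>b. mv_expansion F a r b"
  shows "mv_analytic_on F U"
  using assms by (auto simp: mv_analytic_on_def mv_analytic_at_iff)

lemma mv_analytic_on_has_derivative:
  assumes "mv_analytic_on F U" "x \<in> U"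
  shows "(F has_derivative (\<lambda>v. dird v F x)) (at x)"
proof -
  obtain r b where "r > 0" "mv_expansion F x r b"
    using assms by (rule mv_analytic_onE)
  note D = mv_expansion_has_derivative[OF this(2,1)]
  show ?thesis using D by (simp add: has_derivative_imp_dird[OF D])
qed

lemma mv_analytic_on_continuous: "mv_analytic_on F U \<Longrightarrow> continuous_on U F"
  using mv_analytic_on_has_derivative has_derivative_continuous
  by (blast intro: continuous_at_imp_continuous_on)

lemma mv_analytic_on_partial: "mv_analytic_on F U \<Longrightarrow> mv_analytic_on (partial i F) U"
  by (intro mv_analytic_onI) (meson mv_analytic_onE mv_expansion_partial)

lemma mv_analytic_on_add:
  assumes "mv_analytic_on F U" "mv_analytic_on G U"
  shows "mv_analytic_on (\<lambda>x. F x + G x) U"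
proof (rule mv_analytic_onI)
  fix a assume a: "a \<in> U"
  obtain r b where "r > 0" and F: "mv_expansion F a r b" using assms(1) a by (rule mv_analytic_onE)
  moreover obtain s c where "s > 0" and G: "mv_expansion G a s c" using assms(2) a by (rule mv_analytic_onE)
  moreover have "mv_expansion (\<lambda>x. F x + G x) a (min r s) (\<lambda>k. b k + c k)"
    using F G by (auto simp: mv_expansion_def distrib_right intro!: has_sum_add)
  ultimately show "\<exists>r>0. \<exists>b. mv_expansion (\<lambda>x. F x + G x) a r b"
    by (meson min_less_iff_conj)
qed

lemma mv_analytic_on_mult:
  assumes "mv_analytic_on F U" "mv_analytic_on G U"
  shows "mv_analytic_on (\<lambda>x. F x * G x) U"
proof (rule mv_analytic_onI)
  fix a assume a: "a \<in> U"
  obtain r b where "r > 0" and F: "mv_expansion F a r b" using assms(1) a by (rule mv_analytic_onE)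
  moreover obtain s c where "s > 0" and G: "mv_expansion G a s c" using assms(2) a by (rule mv_analytic_onE)
  ultimately have "mv_expansion F a (min r s) b" "mv_expansion G a (min r s) c" and "min r s > 0"
    by (auto intro: mv_expansion_mono)
  from this(3) mv_expansion_mult[OF this(1,2)]
  show "\<exists>r>0. \<exists>b. mv_expansion (\<lambda>x. F x * G x) a r b"
    by blast
qed

lemma mv_analytic_on_const: "mv_analytic_on (\<lambda>x. c) U"
proof (rule mv_analytic_onI)
  fix a :: "complex ^ 'a"
  have "mv_expansion (\<lambda>x. c) a 1 (\<lambda>k. if k = (\<lambda>_. 0) then c else 0)"
    unfolding mv_expansion_def
    by (auto intro!: has_sum_finite_neutralI[of "{\<lambda>_. 0}"] simp: vpow_def split: if_splits)
  then show "\<exists>r>0. \<exists>b. mv_expansion (\<lambda>x. c) a r b" by (meson zero_less_one)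
qed

lemma mv_analytic_on_coord: "mv_analytic_on (\<lambda>x. x $ j) U"
proof (rule mv_analytic_onI)
  fix a :: "complex ^ 'a"
  let ?e = "(\<lambda>_. 0)(j := 1) :: 'a \<Rightarrow> nat"
  have e: "?e \<noteq> (\<lambda>_. 0)"
    by (metis fun_upd_same zero_neq_one)
  have "mv_expansion (\<lambda>x. x $ j) a 1 (\<lambda>k. if k = (\<lambda>_. 0) then a $ j else if k = ?e then 1 else 0)"
    unfolding mv_expansion_def
  proof
    fix x
    have "vpow (x - a) ?e = x $ j - a $ j"
      unfolding vpow_remove[of _ _ j] by simp
    then show "((\<lambda>k. (if k = (\<lambda>_. 0) then a $ j else if k = ?e then 1 else 0) * vpow (x - a) k)
        has_sum x $ j) UNIV"
      using e by (intro has_sum_finite_neutralI[of "{\<lambda>_. 0, ?e}"]) (auto simp: vpow_def)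
  qed
  then show "\<exists>r>0. \<exists>b. mv_expansion (\<lambda>x. x $ j) a r b" by (meson zero_less_one)
qed

lemma mv_analytic_on_sum:
  "(\<And>j. j \<in> J \<Longrightarrow> mv_analytic_on (F j) U) \<Longrightarrow> mv_analytic_on (\<lambda>x. \<Sum>j\<in>J. F j x) U"
  by (induction J rule: infinite_finite_induct)
     (auto intro: mv_analytic_on_const mv_analytic_on_add)

lemma mv_analytic_on_cmult: "mv_analytic_on F U \<Longrightarrow> mv_analytic_on (\<lambda>x. c * F x) U"
  by (intro mv_analytic_on_mult mv_analytic_on_const)

lemma mv_analytic_on_diff:
  "mv_analytic_on F U \<Longrightarrow> mv_analytic_on G U \<Longrightarrow> mv_analytic_on (\<lambda>x. F x - G x) U"
  using mv_analytic_on_add[OF _ mv_analytic_on_cmult[of G U "-1"]] by simp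

lemma mv_analytic_on_dird: "mv_analytic_on F U \<Longrightarrow> mv_analytic_on (dird v F) U"
  unfolding dird_eq[abs_def] by (intro mv_analytic_on_sum mv_analytic_on_cmult mv_analytic_on_partial)

lemmas mv_analytic_intros =
  mv_analytic_on_const mv_analytic_on_coord mv_analytic_on_add mv_analytic_on_diff
  mv_analytic_on_mult mv_analytic_on_sum mv_analytic_on_partial mv_analytic_on_dird

text \<open>Each side is the constant coefficient of the twice differentiated series, and for
  distinct indices both are the same second-order coefficient of \<open>F\<close>.\<close>

lemma partial_commute:
  assumes "mv_analytic_on F U" "x \<in> U"
  shows "partial i (partial j F) x = partial j (partial i F) x"
proof -
  obtain r b where r: "r > 0" and b: "mv_expansion F x r b"
    using assms by (rule mv_analytic_onE)
  show ?thesis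
    using mv_expansion_center[OF mv_expansion_partial[OF mv_expansion_partial[OF b, of j], of i] r]
      mv_expansion_center[OF mv_expansion_partial[OF mv_expansion_partial[OF b, of i], of j] r]
    by (cases "i = j") (auto simp: fun_upd_twist)
qed

section \<open>Calculus rules for directional derivatives\<close>

context
  fixes U :: "(complex ^ 'n) set" and F G :: "complex ^ 'n \<Rightarrow> complex" and x :: "complex ^ 'n"
  assumes F: "mv_analytic_on F U" and G: "mv_analytic_on G U" and x: "x \<in> U"
begin

lemma dird_add: "dird v (\<lambda>x. F x + G x) x = dird v F x + dird v G x"
proof -
  have "((\<lambda>x. F x + G x) has_derivative
      (\<lambda>v. \<Sum>i\<in>UNIV. v $ i * (partial i F x + partial i G x))) (at x)"
    using has_derivative_add[OF mv_analytic_on_has_derivative[OF F x] mv_analytic_on_has_derivative[OF G x]]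
    by (simp add: dird_eq distrib_left sum.distrib)
  from has_derivative_imp_dird[OF this] show ?thesis
    by (simp add: dird_eq distrib_left sum.distrib)
qed

lemma dird_mult: "dird v (\<lambda>x. F x * G x) x = F x * dird v G x + dird v F x * G x"
proof -
  have *: "F x * dird v G x + dird v F x * G x =
      (\<Sum>i\<in>UNIV. v $ i * (F x * partial i G x + partial i F x * G x))" for v
    by (simp add: dird_eq distrib_left sum.distrib sum_distrib_left sum_distrib_right mult_ac)
  have "((\<lambda>x. F x * G x) has_derivative
      (\<lambda>v. \<Sum>i\<in>UNIV. v $ i * (F x * partial i G x + partial i F x * G x))) (at x)"
    using has_derivative_mult[OF mv_analytic_on_has_derivative[OF F x] mv_analytic_on_has_derivative[OF G x]]
    by (simp only: *)
  from has_derivative_imp_dird[OF this] show ?thesis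
    by (simp only: *)
qed

end

lemma dird_const: "dird v (\<lambda>_. c) x = 0"
  using has_derivative_imp_dird[of "\<lambda>_. c" "\<lambda>_. 0" x v] by simp

lemma dird_cmult:
  assumes "mv_analytic_on F U" "x \<in> U"
  shows "dird v (\<lambda>x. c * F x) x = c * dird v F x"
  using dird_mult[OF mv_analytic_on_const assms] by (simp add: dird_const)

lemma dird_diff:
  assumes "mv_analytic_on F U" "mv_analytic_on G U" "x \<in> U"
  shows "dird v (\<lambda>x. F x - G x) x = dird v F x - dird v G x"
  using dird_add[OF assms(1) mv_analytic_on_cmult[OF assms(2), of "-1"] assms(3)]
    dird_cmult[OF assms(2,3), of _ "-1"] by simp

lemma dird_sum:
  assumes "\<And>j. j \<in> J \<Longrightarrow> mv_analytic_on (F j) U" "x \<in> U"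
  shows "dird v (\<lambda>x. \<Sum>j\<in>J. F j x) x = (\<Sum>j\<in>J. dird v (F j) x)"
  using assms(1)
proof (induction J rule: infinite_finite_induct)
  case (insert j J)
  then show ?case
    using dird_add[of "F j" U "\<lambda>x. \<Sum>j\<in>J. F j x" x v] assms(2)
    by (simp add: mv_analytic_on_sum)
qed (auto simp: dird_const)

lemma dird_coord: "dird v (\<lambda>x. x $ j) x = v $ j"
proof -
  have *: "(\<Sum>i\<in>UNIV. v $ i * (if i = j then 1 else 0)) = v $ j" for v :: "complex ^ 'a"
    by (simp add: if_distrib[of "(*) _"] cong: if_cong)
  have "((\<lambda>x. x $ j) has_derivative (\<lambda>v. v $ j)) (at x)"
    by (intro bounded_linear_imp_has_derivative bounded_linear_vec_nth)
  then show ?thesis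
    using has_derivative_imp_dird[of "\<lambda>x. x $ j" "\<lambda>i. if i = j then 1 else 0" x v]
    by (simp only: *)
qed

lemma partial_dird_commute:
  assumes "mv_analytic_on F U" "x \<in> U"
  shows "partial i (dird v F) x = dird v (partial i F) x"
proof -
  have "dird v F = (\<lambda>x. \<Sum>j\<in>UNIV. v $ j * partial j F x)"
    by (simp add: fun_eq_iff dird_eq)
  then have "partial i (dird v F) x = dird (axis i 1) (\<lambda>x. \<Sum>j\<in>UNIV. v $ j * partial j F x) x"
    by (simp only: dird_axis)
  also have "\<dots> = (\<Sum>j\<in>UNIV. v $ j * dird (axis i 1) (partial j F) x)"
    using assms
    by (simp add: dird_sum[where U = U] dird_cmult[where U = U] mv_analytic_on_cmult mv_analytic_on_partial)
  also have "\<dots> = dird v (partial i F) x"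
    by (simp add: dird_axis dird_eq partial_commute[OF assms, of i])
  finally show ?thesis .
qed

lemma dird_cong:
  assumes "open U" "x \<in> U" "\<And>y. y \<in> U \<Longrightarrow> F y = G y"
  shows "dird v F x = dird v G x"
proof -
  have "partial i F x = partial i G x" for i
    unfolding partial_def
  proof (rule deriv_cong_ev)
    have "((\<lambda>t. x + t *s axis i 1) \<longlongrightarrow> x + 0 *s axis i 1) (nhds 0)"
      unfolding vector_scalar_mult_def by (intro tendsto_intros tendsto_vec_lambda filterlim_ident)
    then have "eventually (\<lambda>t. x + t *s axis i 1 \<in> U) (nhds 0)"
      using assms(1,2) by (intro topological_tendstoD) auto
    then show "eventually (\<lambda>t. F (x + t *s axis i 1) = G (x + t *s axis i 1)) (nhds 0)"
      by eventually_elim (rule assms(3))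
  qed simp
  then show ?thesis by (simp add: dird_eq)
qed

subsection \<open>Order of vanishing and the identity theorem\<close>

text \<open>In \<open>fold dird vs F\<close> the head of \<open>vs\<close> is applied first, so
  inductions on \<open>vs\<close> must generalize over \<open>F\<close>.\<close>

lemma mv_analytic_on_fold_dird: "mv_analytic_on F U \<Longrightarrow> mv_analytic_on (fold dird vs F) U"
  by (induction vs arbitrary: F) (auto intro: mv_analytic_on_dird)

lemma fold_dird_cong:
  assumes "open U" "x \<in> U" "\<And>y. y \<in> U \<Longrightarrow> F y = G y"
  shows "fold dird vs F x = fold dird vs G x"
  using assms(3)
proof (induction vs arbitrary: F G)
  case (Cons v vs)
  show ?case
    using Cons.IH[of "dird v F" "dird v G"] dird_cong[OF assms(1) _ Cons.prems] by simp
qed (use assms(2) in auto)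

lemma fold_dird_zero: "fold dird vs (\<lambda>_. 0) = (\<lambda>_. 0)"
  by (induction vs) (auto simp: dird_const[abs_def])

lemma fold_dird_add:
  assumes "open U" "x \<in> U" "mv_analytic_on F U" "mv_analytic_on G U"
  shows "fold dird vs (\<lambda>x. F x + G x) x = fold dird vs F x + fold dird vs G x"
  using assms(3,4)
proof (induction vs arbitrary: F G)
  case (Cons v vs)
  have "fold dird (v # vs) (\<lambda>x. F x + G x) x = fold dird vs (\<lambda>x. dird v F x + dird v G x) x"
    using Cons.prems by (auto intro!: fold_dird_cong[OF assms(1,2)] dird_add)
  then show ?case
    using Cons by (simp add: mv_analytic_on_dird)
qed simp

lemma fold_dird_cmult:
  assumes "open U" "x \<in> U" "mv_analytic_on F U"
  shows "fold dird vs (\<lambda>x. c * F x) x = c * fold dird vs F x"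
  using assms(3)
proof (induction vs arbitrary: F)
  case (Cons v vs)
  have "fold dird (v # vs) (\<lambda>x. c * F x) x = fold dird vs (\<lambda>x. c * dird v F x) x"
    using Cons.prems by (auto intro!: fold_dird_cong[OF assms(1,2)] dird_cmult)
  then show ?case
    using Cons by (simp add: mv_analytic_on_dird)
qed simp

lemma fold_dird_diff:
  assumes "open U" "x \<in> U" "mv_analytic_on F U" "mv_analytic_on G U"
  shows "fold dird vs (\<lambda>x. F x - G x) x = fold dird vs F x - fold dird vs G x"
  using fold_dird_add[OF assms(1-3) mv_analytic_on_cmult[OF assms(4), of "-1"]]
    fold_dird_cmult[OF assms(1,2,4), of vs "-1"] by simp

lemma fold_dird_sum:
  assumes "open U" "x \<in> U" "\<And>j. j \<in> J \<Longrightarrow> mv_analytic_on (F j) U"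
  shows "fold dird vs (\<lambda>x. \<Sum>j\<in>J. F j x) x = (\<Sum>j\<in>J. fold dird vs (F j) x)"
  using assms(3)
proof (induction J rule: infinite_finite_induct)
  case (insert j J)
  then show ?case
    using fold_dird_add[OF assms(1,2), of "F j" "\<lambda>x. \<Sum>j\<in>J. F j x" vs]
    by (simp add: mv_analytic_on_sum)
qed (auto simp: fold_dird_zero)

text \<open>Order of vanishing at least \<open>m\<close>. Allowing words in all directions keeps the
  notion independent of coordinates, so that eigendirections can be substituted later.\<close>

definition vanishes_to :: "nat \<Rightarrow> (complex ^ 'n \<Rightarrow> complex) \<Rightarrow> complex ^ 'n \<Rightarrow> bool" where
  "vanishes_to m F a \<longleftrightarrow> (\<forall>vs. length vs < m \<longrightarrow> fold dird vs F a = 0)"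

lemma vanishes_to_0 [simp]: "vanishes_to 0 F a"
  by (simp add: vanishes_to_def)

lemma vanishes_to_Suc:
  fixes a :: "complex ^ 'n"
  shows "vanishes_to (Suc m) F a \<longleftrightarrow> F a = 0 \<and> (\<forall>v. vanishes_to m (dird v F) a)"
proof
  assume L: "vanishes_to (Suc m) F a"
  have "F a = 0" using L[unfolded vanishes_to_def, rule_format, of "[]"] by simp
  moreover have "fold dird vs (dird v F) a = 0" if "length vs < m" for v vs
    using L[unfolded vanishes_to_def, rule_format, of "v # vs"] that by simp
  ultimately show "F a = 0 \<and> (\<forall>v. vanishes_to m (dird v F) a)"
    by (simp add: vanishes_to_def)
next
  assume R: "F a = 0 \<and> (\<forall>v. vanishes_to m (dird v F) a)"
  show "vanishes_to (Suc m) F a"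
    unfolding vanishes_to_def
  proof (intro allI impI)
    fix vs :: "(complex ^ 'n) list" assume "length vs < Suc m"
    with R show "fold dird vs F a = 0" by (cases vs) (auto simp: vanishes_to_def)
  qed
qed

lemma vanishes_to_mono: "vanishes_to n F a \<Longrightarrow> m \<le> n \<Longrightarrow> vanishes_to m F a"
  by (auto simp: vanishes_to_def)

lemma vanishes_to_cong:
  assumes "open U" "a \<in> U" "\<And>y. y \<in> U \<Longrightarrow> F y = G y"
  shows "vanishes_to m F a \<longleftrightarrow> vanishes_to m G a"
  unfolding vanishes_to_def using fold_dird_cong[OF assms] by simp

lemma vanishes_to_add:
  assumes "open U" "a \<in> U" "mv_analytic_on F U" "mv_analytic_on G U"
    and "vanishes_to m F a" "vanishes_to m G a"
  shows "vanishes_to m (\<lambda>x. F x + G x) a"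
  using assms(5,6) by (simp add: vanishes_to_def fold_dird_add[OF assms(1-4)])

lemma vanishes_to_sum:
  assumes "open U" "a \<in> U" "\<And>j. j \<in> J \<Longrightarrow> mv_analytic_on (F j) U"
    and "\<And>j. j \<in> J \<Longrightarrow> vanishes_to m (F j) a"
  shows "vanishes_to m (\<lambda>x. \<Sum>j\<in>J. F j x) a"
  using assms(4) by (simp add: vanishes_to_def fold_dird_sum[OF assms(1-3)])

text \<open>Leibniz rule with induction on the total order: a derivative of the product is a sum of
  two products whose orders add up to one less.\<close>

lemma vanishes_to_mult:
  assumes "open U" "a \<in> U" "mv_analytic_on F U" "mv_analytic_on G U"
    and "vanishes_to m F a" "vanishes_to p G a"
  shows "vanishes_to (m + p) (\<lambda>x. F x * G x) a"
  using assms(3-)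
proof (induction "m + p" arbitrary: m p F G)
  case (Suc N)
  have "F a * G a = 0"
    using Suc.hyps(2) Suc.prems(3,4) by (cases m; cases p) (auto simp: vanishes_to_Suc)
  moreover have "vanishes_to N (dird v (\<lambda>x. F x * G x)) a" for v
  proof -
    \<comment> \<open>Stated for arbitrary factors so that it serves both Leibniz summands. If
      \<open>m\<close> is 0, the order comes from the undifferentiated factor alone.\<close>
    have 1: "vanishes_to N (\<lambda>x. dird v F x * G x) a"
      if an: "mv_analytic_on F U" "mv_analytic_on G U"
        and v: "vanishes_to m F a" "vanishes_to p G a" "Suc N = m + p" for F G m p
    proof (cases m)
      case 0
      then show ?thesis
        using Suc.hyps(1)[of 0 N "dird v F" G] an v
        by (simp add: mv_analytic_on_dird vanishes_to_mono[of p])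
    next
      case (Suc m')
      then show ?thesis
        using Suc.hyps(1)[of m' p "dird v F" G] an v
        by (simp add: mv_analytic_on_dird vanishes_to_Suc)
    qed
    have "vanishes_to N (\<lambda>x. dird v F x * G x) a" "vanishes_to N (\<lambda>x. dird v G x * F x) a"
      using 1[of F G m p] 1[of G F p m] Suc by (auto simp: add.commute)
    then have "vanishes_to N (\<lambda>x. F x * dird v G x + dird v F x * G x) a"
      using Suc.prems assms(1,2)
      by (intro vanishes_to_add[of U]) (auto intro: mv_analytic_intros simp: mult.commute)
    then show ?thesis
      using Suc.prems by (subst vanishes_to_cong[OF assms(1,2)]) (auto intro: dird_mult)
  qed
  ultimately show ?case using Suc.hyps(2) by (metis vanishes_to_Suc)
qed simp

text \<open>Up to a positive integer factor, a coefficient with \<open>k i\<close> nonzero is a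
  coefficient of \<open>partial i F\<close> of lower total degree.\<close>

lemma vanishing_expansion:
  assumes "mv_expansion F a r b" "r > 0" "\<And>m. vanishes_to m F a"
  shows "b k = 0"
  using assms
proof (induction "sum k UNIV" arbitrary: k F b)
  case 0
  then have "k = (\<lambda>_. 0)" by (auto simp: fun_eq_iff)
  with 0 show ?case using mv_expansion_center vanishes_to_Suc by metis
next
  case (Suc N)
  then obtain i where i: "k i \<noteq> 0" by (metis finite sum.neutral nat.distinct(1))
  define k' where "k' = k(i := k i - 1)"
  have k: "k'(i := k' i + 1) = k" using i by (auto simp: k'_def fun_eq_iff)
  have "sum k UNIV = sum k' UNIV + 1"
    using i by (simp add: sum.remove[of UNIV i] k'_def)
  then have "N = sum k' UNIV" using Suc.hyps(2) by simp
  moreover have "vanishes_to m (partial i F) a" for m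
    using Suc.prems(3)[of "Suc m"] by (simp add: vanishes_to_Suc flip: dird_axis)
  ultimately have "of_nat (k' i + 1) * b (k'(i := k' i + 1)) = 0"
    using Suc.hyps(1)[OF _ mv_expansion_partial[OF Suc.prems(1), of i] Suc.prems(2)] by blast
  then show ?case unfolding k by (simp del: of_nat_add of_nat_Suc)
qed

text \<open>The points where all iterated derivatives vanish form a set that is open, because the
  Taylor series there is zero, and closed in \<open>U\<close> by continuity.\<close>

lemma vanishing_identity:
  fixes F :: "complex ^ 'n \<Rightarrow> complex"
  assumes U: "open U" "connected U" and F: "mv_analytic_on F U"
    and a: "a \<in> U" "\<And>m. vanishes_to m F a" and x: "x \<in> U"
  shows "F x = 0"
proof -
  define S where "S = {x \<in> U. \<forall>vs. fold dird vs F x = 0}"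
  have "open S"
    unfolding open_contains_ball
  proof
    fix y assume y: "y \<in> S"
    then have yU: "y \<in> U" and flat: "vanishes_to m F y" for m
      by (auto simp: S_def vanishes_to_def)
    obtain r b where r: "r > 0" and b: "mv_expansion F y r b"
      using F yU by (rule mv_analytic_onE)
    obtain s where s: "s > 0" "ball y s \<subseteq> U"
      using U(1) yU by (auto simp: open_contains_ball)
    have zero: "F z = 0" if "z \<in> ball y r" for z
    proof -
      have "((\<lambda>k :: 'n \<Rightarrow> nat. 0) has_sum F z) UNIV"
        using b that vanishing_expansion[OF b r flat] by (auto simp: mv_expansion_def)
      then show ?thesis by (metis has_sum_0_simp has_sum_unique)
    qed
    have "ball y (min r s) \<subseteq> S"
      using s zero
      by (auto simp: S_def fold_dird_zero
          intro!: fold_dird_cong[of "ball y (min r s)" _ F "\<lambda>_. 0", THEN trans])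
    then show "\<exists>e>0. ball y e \<subseteq> S" using r s by (meson min_less_iff_conj)
  qed
  then have "openin (top_of_set U) S"
    by (auto simp: S_def intro: openin_open_eq[OF U(1), THEN iffD2])
  moreover have "closedin (top_of_set U) S"
  proof -
    have "S = U \<inter> (\<Inter>vs. {x \<in> U. fold dird vs F x = 0})" by (auto simp: S_def)
    moreover have "closedin (top_of_set U) {x \<in> U. fold dird vs F x = 0}" for vs
      by (intro continuous_closedin_preimage_constant mv_analytic_on_continuous mv_analytic_on_fold_dird F)
    ultimately show ?thesis by (auto intro!: closedin_Int closedin_INT)
  qed
  moreover have "a \<in> S"
    using a by (auto simp: S_def vanishes_to_def)
  ultimately have "S = U" using U(2) by (auto simp: connected_clopen)
  then have "fold dird [] F x = 0" using x unfolding S_def by blast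
  then show ?thesis by simp
qed

subsection \<open>Brackets with linear fields\<close>

definition linear_field :: "complex ^ 'n ^ 'n \<Rightarrow> complex ^ 'n \<Rightarrow> complex ^ 'n \<Rightarrow> complex ^ 'n" where
  "linear_field A a x = A *v (x - a)"

lemma mv_analytic_on_vf_apply:
  "analytic_field_on X U \<Longrightarrow> mv_analytic_on F U \<Longrightarrow> mv_analytic_on (vf_apply X F) U"
  unfolding vf_apply_def[abs_def] analytic_field_on_def by (intro mv_analytic_intros) auto

lemma linear_field_nth: "linear_field A a x $ i = (\<Sum>j\<in>UNIV. A $ i $ j * (x $ j - a $ j))"
  by (simp add: linear_field_def matrix_vector_mult_def)

lemma analytic_linear_field: "analytic_field_on (linear_field A a) U"
  unfolding analytic_field_on_def linear_field_nth by (intro allI mv_analytic_intros)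

lemma dird_linear_field: "dird v (\<lambda>x. linear_field A a x $ i) x = (A *v v) $ i"
proof -
  have "dird v (\<lambda>x. linear_field A a x $ i) x = (\<Sum>j\<in>UNIV. A $ i $ j * (v $ j - 0))"
    unfolding linear_field_nth
    by (subst dird_sum[of _ _ UNIV] dird_cmult[of _ UNIV] dird_diff[of _ UNIV], simp_all add: mv_analytic_intros)+
       (simp add: dird_coord dird_const)
  then show ?thesis by (simp add: matrix_vector_mult_def)
qed

text \<open>A direction \<open>v\<close> that is an eigenvector of \<open>A\<close> satisfies \<open>[v, L] = d v\<close> for the linear field \<open>L\<close>
  with matrix \<open>A\<close>; pushing the derivatives through \<open>L\<close>, which vanishes at \<open>a\<close>, leaves the sum of the \<open>d\<close>.\<close>

lemma dird_vf_apply_linear_field: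
  assumes F: "mv_analytic_on F U" and x: "x \<in> U" and v: "A *v v = d *s v"
  shows "dird v (vf_apply (linear_field A a) F) x = vf_apply (linear_field A a) (dird v F) x + d * dird v F x"
proof -
  let ?L = "linear_field A a"
  have L: "mv_analytic_on (\<lambda>x. ?L x $ i) U" for i
    using analytic_linear_field by (auto simp: analytic_field_on_def)
  have "dird v (vf_apply ?L F) x = (\<Sum>i\<in>UNIV. dird v (\<lambda>x. ?L x $ i * partial i F x) x)"
    unfolding vf_apply_def[abs_def]
    by (intro dird_sum[of _ _ U] mv_analytic_on_mult L mv_analytic_on_partial F x)
  also have "\<dots> = (\<Sum>i\<in>UNIV. ?L x $ i * partial i (dird v F) x + (A *v v) $ i * partial i F x)"
    by (intro sum.cong refl)
       (simp add: dird_mult[OF L mv_analytic_on_partial[OF F] x] dird_linear_field partial_dird_commute[OF F x])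
  also have "\<dots> = vf_apply ?L (dird v F) x + d * dird v F x"
    unfolding v by (simp add: sum.distrib vf_apply_def dird_eq sum_distrib_left mult.assoc)
  finally show ?thesis .
qed

lemma fold_dird_vf_apply_linear_field:
  assumes U: "open U" "a \<in> U" and F: "mv_analytic_on F U"
    and p: "\<And>j. A *v p j = d j *s p j"
  shows "fold dird (map p js) (vf_apply (linear_field A a) F) a = sum_list (map d js) * fold dird (map p js) F a"
  using F
proof (induction js arbitrary: F)
  case Nil
  then show ?case by (simp add: vf_apply_def linear_field_def)
next
  case (Cons j js)
  let ?L = "linear_field A a" and ?F = "dird (p j) F"
  have "fold dird (map p (j # js)) (vf_apply ?L F) a = fold dird (map p js) (\<lambda>x. vf_apply ?L ?F x + d j * ?F x) a"
    using Cons.prems by (auto intro!: fold_dird_cong[OF U] dird_vf_apply_linear_field p)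
  also have "\<dots> = fold dird (map p js) (vf_apply ?L ?F) a + d j * fold dird (map p js) ?F a"
    using Cons.prems(1) U
    by (simp add: fold_dird_add[of U] fold_dird_cmult[of U] mv_analytic_on_cmult mv_analytic_on_dird
        mv_analytic_on_vf_apply analytic_linear_field)
  also have "fold dird (map p js) (vf_apply ?L ?F) a = sum_list (map d js) * fold dird (map p js) ?F a"
    using Cons.prems by (intro Cons.IH) (auto intro: mv_analytic_on_dird)
  finally show ?case by (simp add: algebra_simps)
qed

text \<open>Iterated derivatives are multilinear in their directions, so values on words of spanning
  vectors determine them. Here \<open>q v\<close> lists coefficients of \<open>v\<close> in the
  family \<open>p\<close>.\<close>

lemma fold_dird_spanning:
  assumes U: "open U" "a \<in> U" and F: "mv_analytic_on F U"
    and span: "\<And>v. v = (\<Sum>j\<in>UNIV. q v j *s (p j :: complex ^ 'n))"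
    and zero: "\<And>js. length js = length us \<Longrightarrow> fold dird (map p js) F a = 0"
  shows "fold dird us F a = 0"
  using F zero
proof (induction us arbitrary: F)
  case (Cons u us)
  have IH: "fold dird us (dird (p j) F) a = 0" for j
  proof (rule Cons.IH)
    show "fold dird (map p js) (dird (p j) F) a = 0" if "length js = length us" for js
      using Cons.prems(2)[of "j # js"] that by simp
  qed (use Cons.prems in \<open>auto intro: mv_analytic_on_dird\<close>)
  have "dird u F x = (\<Sum>j\<in>UNIV. q u j * dird (p j) F x)" for x
    by (subst span[of u]) (simp add: dird_vec_sum dird_vec_scale)
  then have "dird u F = (\<lambda>x. \<Sum>j\<in>UNIV. q u j * dird (p j) F x)" by (simp add: fun_eq_iff)
  then have "fold dird (u # us) F a = fold dird us (\<lambda>x. \<Sum>j\<in>UNIV. q u j * dird (p j) F x) a"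
    by simp
  also have "\<dots> = (\<Sum>j\<in>UNIV. q u j * fold dird us (dird (p j) F) a)"
    using U Cons.prems(1)
    by (simp add: fold_dird_sum[of U] fold_dird_cmult[of U] mv_analytic_on_cmult mv_analytic_on_dird)
  finally show ?case by (simp add: IH)
qed auto

lemma nonzero_iterated_derivative:
  assumes U: "open U" "a \<in> U" and F: "mv_analytic_on F U"
    and span: "\<And>v. v = (\<Sum>j\<in>UNIV. q v j *s (p j :: complex ^ 'n))"
    and m: "vanishes_to m F a" "\<not> vanishes_to (Suc m) F a"
  shows "\<exists>js. length js = m \<and> fold dird (map p js) F a \<noteq> 0"
proof -
  obtain us where us: "length us < Suc m" "fold dird us F a \<noteq> 0"
    using m(2) by (auto simp: vanishes_to_def)
  moreover have "length us = m"
    using us m(1) unfolding vanishes_to_def by (metis less_SucE)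
  ultimately show ?thesis
    using fold_dird_spanning[OF U F span, of us] by metis
qed

text \<open>The lowest-order homogeneous part of \<open>\<phi>\<close> at the equilibrium \<open>a\<close> of \<open>h\<close> is an eigenvector of the
  bracket with the linear part of \<open>h\<close>. Instead of the homogeneous part we use the tensor of its
  derivatives in eigendirections of the Jacobian.\<close>

lemma lowest_order_eigenvector:
  fixes h \<phi> :: "complex ^ 'n \<Rightarrow> complex ^ 'n"
  assumes U: "open U" "connected U" "a \<in> U"
    and h: "analytic_field_on h U" and ha: "h a = 0"
    and \<phi>: "analytic_field_on \<phi> U" and x0: "x0 \<in> U" "\<phi> x0 \<noteq> 0"
    and bracket: "\<And>x i. x \<in> U \<Longrightarrow>
      vf_apply h (\<lambda>y. \<phi> y $ i) x - vf_apply \<phi> (\<lambda>y. h y $ i) x = \<mu> * \<phi> x $ i"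
    and p: "\<And>j. jacobian h a *v p j = d j *s p j"
    and span: "\<And>v. v = (\<Sum>j\<in>UNIV. q v j *s p j)"
  shows "\<exists>js W. W \<noteq> 0 \<and> jacobian h a *v W = (sum_list (map d js) - \<mu>) *s W"
proof -
  define A where "A = jacobian h a"
  let ?L = "linear_field A a"
  have \<phi>i: "mv_analytic_on (\<lambda>y. \<phi> y $ i) U" and hi: "mv_analytic_on (\<lambda>y. h y $ i) U"
    and Li: "mv_analytic_on (\<lambda>y. ?L y $ i) U" for i
    using \<phi> h analytic_linear_field[of A a U] by (auto simp: analytic_field_on_def)
  have "\<exists>m i. \<not> vanishes_to (Suc m) (\<lambda>y. \<phi> y $ i) a"
  proof (rule ccontr)
    assume "\<not> ?thesis"
    then have "vanishes_to m (\<lambda>y. \<phi> y $ i) a" for m i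
      by (meson vanishes_to_mono le_SucI order_refl)
    then have "\<phi> x0 $ i = 0" for i
      using vanishing_identity[OF U(1,2) \<phi>i U(3) _ x0(1)] by blast
    with x0(2) show False by (simp add: vec_eq_iff)
  qed
  \<comment> \<open>The lowest order over all components: every component vanishes to order
    \<open>m\<close>, and \<open>i0\<close> is one that does not vanish further.\<close>
  define m where "m = (LEAST m. \<exists>i. \<not> vanishes_to (Suc m) (\<lambda>y. \<phi> y $ i) a)"
  obtain i0 where i0: "\<not> vanishes_to (Suc m) (\<lambda>y. \<phi> y $ i0) a"
    unfolding m_def using LeastI_ex[OF \<open>\<exists>m i. _ m i\<close>] by blast
  have m: "vanishes_to m (\<lambda>y. \<phi> y $ i) a" for i
  proof (cases m)
    case (Suc m')
    then have "m' < m" by simp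
    from not_less_Least[OF this[unfolded m_def]] Suc show ?thesis by auto
  qed simp
  obtain js where js: "length js = m" "fold dird (map p js) (\<lambda>y. \<phi> y $ i0) a \<noteq> 0"
    using nonzero_iterated_derivative[OF U(1,3) \<phi>i span m i0] by blast
  \<comment> \<open>The same word \<open>js\<close> is used in all components; component
    \<open>i0\<close> makes the vector nonzero.\<close>
  define W where "W = (\<chi> i. fold dird (map p js) (\<lambda>y. \<phi> y $ i) a)"
  have W0: "W \<noteq> 0" using js(2) by (auto simp: W_def vec_eq_iff)
  have "(A *v W) $ i = ((sum_list (map d js) - \<mu>) *s W) $ i" for i
  proof -
    let ?\<phi> = "\<lambda>y. \<phi> y $ i" and ?h = "\<lambda>y. h y $ i"
    \<comment> \<open>\<open>?R\<close> is the error of replacing \<open>h\<close> by its linear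
      part in the bracket, and the bracket hypothesis turns it into \<open>?S\<close>. Its products
      have orders 2 plus \<open>m - 1\<close>, and \<open>m\<close> plus 1, so derivatives of length
      \<open>m\<close> do not see it. The truncation of \<open>m - 1\<close> at \<open>m = 0\<close>
      is harmless.\<close>
    let ?R = "\<lambda>x. (\<Sum>j\<in>UNIV. (?L x $ j - h x $ j) * partial j ?\<phi> x)
      + (\<Sum>j\<in>UNIV. \<phi> x $ j * (partial j ?h x - A $ i $ j))"
    let ?S = "\<lambda>x. vf_apply ?L ?\<phi> x - (\<Sum>j\<in>UNIV. A $ i $ j * \<phi> x $ j) - \<mu> * ?\<phi> x"
    have RS: "?R x = ?S x" if "x \<in> U" for x
      unfolding bracket[OF that, of i, symmetric]
      by (simp add: vf_apply_def algebra_simps sum_subtractf sum.distrib)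
    have 1: "vanishes_to (Suc (Suc 0)) (\<lambda>x. ?L x $ j - h x $ j) a" for j
    proof -
      have "dird v (\<lambda>y. h y $ j) a = (A *v v) $ j" for v
        by (simp add: A_def jacobian_def matrix_vector_mult_def dird_eq mult.commute)
      then show ?thesis
        unfolding vanishes_to_Suc dird_diff[OF Li hi U(3)] dird_linear_field
        using ha by (simp add: linear_field_def)
    qed
    have 2: "vanishes_to (Suc 0) (\<lambda>x. partial j ?h x - A $ i $ j) a" for j
      unfolding vanishes_to_Suc by (simp add: A_def jacobian_def)
    have 3: "vanishes_to (m - 1) (partial j ?\<phi>) a" for j
      using m[of i] by (cases m) (auto simp: vanishes_to_Suc simp flip: dird_axis)
    have "vanishes_to (Suc m) (\<lambda>x. (?L x $ j - h x $ j) * partial j ?\<phi> x) a" for j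
      by (rule vanishes_to_mono[OF vanishes_to_mult[OF U(1,3) _ _ 1 3]])
         (auto intro!: mv_analytic_intros Li hi \<phi>i)
    moreover have "vanishes_to (Suc m) (\<lambda>x. \<phi> x $ j * (partial j ?h x - A $ i $ j)) a" for j
      by (rule vanishes_to_mono[OF vanishes_to_mult[OF U(1,3) _ _ m[of j] 2]])
         (auto intro!: mv_analytic_intros hi \<phi>i)
    ultimately have "vanishes_to (Suc m) ?R a"
      by (intro vanishes_to_add[OF U(1,3)] vanishes_to_sum[OF U(1,3)] mv_analytic_intros Li hi \<phi>i) auto
    then have "vanishes_to (Suc m) ?S a"
      by (subst (asm) vanishes_to_cong[OF U(1,3) RS]) assumption+
    then have "0 = fold dird (map p js) ?S a"
      using js(1) by (simp add: vanishes_to_def)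
    also have "\<dots> = fold dird (map p js) (vf_apply ?L ?\<phi>) a
        - (\<Sum>j\<in>UNIV. A $ i $ j * fold dird (map p js) (\<lambda>y. \<phi> y $ j) a)
        - \<mu> * fold dird (map p js) ?\<phi> a"
      using U \<phi>i
      by (simp add: fold_dird_diff[of U] fold_dird_sum[of U] fold_dird_cmult[of U] mv_analytic_intros
          mv_analytic_on_cmult mv_analytic_on_vf_apply analytic_linear_field)
    also have "fold dird (map p js) (vf_apply ?L ?\<phi>) a
        = sum_list (map d js) * fold dird (map p js) ?\<phi> a"
      using p by (intro fold_dird_vf_apply_linear_field[OF U(1,3) \<phi>i]) (simp add: A_def)
    finally show ?thesis
      by (simp add: W_def matrix_vector_mult_def algebra_simps)
  qed
  then have "A *v W = (sum_list (map d js) - \<mu>) *s W" by (simp add: vec_eq_iff)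
  with W0 show ?thesis unfolding A_def by blast
qed

subsection \<open>Eigenbases\<close>

lemma eigenvalue_in_eigenvalues_of:
  fixes K :: "complex ^ 'n ^ 'n"
  assumes "eigenvalues_of K lam" "K *v w = e *s w" "w \<noteq> 0"
  shows "\<exists>i. e = lam i"
proof -
  let ?B = "mat e - K"
  have "?B *v w = 0"
  proof -
    have "mat e *v w = e *s w"
      by (simp add: vec_eq_iff matrix_vector_mult_def mat_def if_distrib[of "\<lambda>z. z * _"] cong: if_cong)
    then show ?thesis
      by (simp add: matrix_vector_mult_diff_rdistrib assms(2))
  qed
  have "\<not> invertible ?B"
  proof
    assume "invertible ?B"
    then obtain B' where "B' ** ?B = mat 1" by (auto simp: invertible_def)
    then have "w = B' *v (?B *v w)" by (simp add: matrix_vector_mul_assoc)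
    with \<open>?B *v w = 0\<close> assms(3) show False by simp
  qed
  then have "det ?B = 0" by (simp add: invertible_det_nz)
  then have "(\<Prod>i\<in>UNIV. e - lam i) = 0" using assms(1) by (simp add: eigenvalues_of_def)
  then show ?thesis by auto
qed

lemma diag_mat_mult_nth: "(diag_mat d *v x) $ i = d i * x $ i"
proof -
  have "(diag_mat d *v x) $ i = (\<Sum>j\<in>UNIV. if j = i then d i * x $ i else 0)"
    unfolding diag_mat_def matrix_vector_mult_def vec_lambda_beta by (intro sum.cong) auto
  then show ?thesis by simp
qed

lemma matrix_inv_mult_right: "invertible A \<Longrightarrow> A ** matrix_inv A = mat 1"
  unfolding invertible_def matrix_inv_def by (metis (mono_tags, lifting) someI_ex)

lemma matrix_inv_mult_left: "invertible A \<Longrightarrow> matrix_inv A ** A = mat 1"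
  unfolding invertible_def matrix_inv_def by (metis (mono_tags, lifting) someI_ex)

text \<open>The columns of the diagonalizing matrix are the basis, and its inverse gives the
  coordinates \<open>q\<close>.\<close>

lemma diagonalizable_eigenbasis:
  fixes K :: "complex ^ 'n ^ 'n"
  assumes "diagonalizable K"
  obtains p :: "'n \<Rightarrow> complex ^ 'n" and d q where "\<And>j. p j \<noteq> 0" "\<And>j. K *v p j = d j *s p j"
    "\<And>v. v = (\<Sum>j\<in>UNIV. q v j *s p j)"
proof -
  obtain P :: "complex ^ 'n ^ 'n" and d where P: "invertible P" and K: "K = P ** diag_mat d ** matrix_inv P"
    using assms unfolding diagonalizable_def by blast
  let ?e = "\<lambda>j. axis j 1 :: complex ^ 'n"
  define p where "p j = P *v ?e j" for j
  have inv: "matrix_inv P *v p j = ?e j" for j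
    by (simp add: p_def matrix_vector_mul_assoc matrix_inv_mult_left[OF P])
  have De: "diag_mat d *v ?e j = d j *s ?e j" for j
    by (simp add: vec_eq_iff diag_mat_mult_nth axis_def)
  have p: "p j = column j P" for j
    by (simp add: p_def vec_eq_iff matrix_vector_mult_def column_def axis_def
        if_distrib[of "(*) _"] cong: if_cong)
  show ?thesis
  proof
    show "p j \<noteq> 0" for j
      using inv[of j] by (metis axis_eq_0_iff matrix_vector_mult_0_right zero_neq_one)
    show "K *v p j = d j *s p j" for j
    proof -
      have "K *v p j = P *v (diag_mat d *v (matrix_inv P *v p j))"
        by (simp add: K matrix_vector_mul_assoc matrix_mul_assoc)
      then show ?thesis
        unfolding inv De by (simp add: p_def vector_scalar_commute)
    qed
    show "v = (\<Sum>j\<in>UNIV. (matrix_inv P *v v) $ j *s p j)" for v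
    proof -
      have "v = P *v (matrix_inv P *v v)"
        by (simp add: matrix_vector_mul_assoc matrix_inv_mult_right[OF P])
      then show ?thesis
        unfolding p by (simp only: matrix_mult_sum[symmetric])
    qed
  qed
qed

subsection \<open>Quasihomogeneous functions\<close>

lemma wscale_nth: "wscale g \<alpha> x $ i = complex_of_real (\<alpha> powr of_rat (g i)) * x $ i"
  by (simp add: wscale_def)

lemma wscale_eq_mult:
  "wscale g \<alpha> x = diag_mat (\<lambda>i. complex_of_real (\<alpha> powr of_rat (g i))) *v x"
  by (simp add: vec_eq_iff wscale_nth diag_mat_mult_nth)

lemma wscale_scale: "wscale g \<alpha> (t *s x) = t *s wscale g \<alpha> x"
  by (simp add: vec_eq_iff wscale_nth)

lemma wscale_zero: "wscale g \<alpha> 0 = 0"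
  by (simp add: vec_eq_iff wscale_nth)

lemma wscale_sum: "wscale g \<alpha> (\<Sum>j\<in>J. x j) = (\<Sum>j\<in>J. wscale g \<alpha> (x j))"
  by (simp add: vec_eq_iff wscale_nth sum_distrib_left)

lemma wscale_one: "wscale g 1 x = x"
  by (simp add: vec_eq_iff wscale_nth)

lemma wscale_inverse: "\<alpha> > 0 \<Longrightarrow> wscale g \<alpha> (wscale g (inverse \<alpha>) x) = x"
  by (simp add: vec_eq_iff wscale_nth powr_mult[symmetric] flip: of_real_mult mult.assoc)

lemma wscale_inverse': "\<alpha> > 0 \<Longrightarrow> wscale g (inverse \<alpha>) (wscale g \<alpha> x) = x"
  using wscale_inverse[of "inverse \<alpha>" g x] by simp

lemma bounded_linear_wscale: "bounded_linear (wscale g \<alpha>)"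
  unfolding wscale_eq_mult[abs_def] by simp

text \<open>Weights occur both as real exponents and as complex matrix entries; this reconciles the
  two embeddings.\<close>

lemma complex_of_real_of_rat [simp]: "complex_of_real (of_rat r) = of_rat r"
  by (cases r) (simp add: of_rat_rat)

text \<open>Differentiate the scaling law in \<alpha> at \<alpha> = 1.\<close>

lemma euler_identity:
  fixes F :: "complex ^ 'n \<Rightarrow> complex"
  assumes F: "mv_analytic_on F U" and x: "x \<in> U"
    and hom: "\<And>\<alpha>. \<alpha> > 0 \<Longrightarrow> F (wscale g \<alpha> x) = complex_of_real (\<alpha> powr w) * F x"
  shows "vf_apply (linear_field (weight_matrix g) 0) F x = complex_of_real w * F x"
proof -
  \<comment> \<open>The orbit of \<open>x\<close> under the scaling, written as a sum of axis
    vectors so that its velocity can be computed term by term.\<close>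
  let ?\<gamma> = "\<lambda>\<alpha>. \<Sum>i\<in>UNIV. (\<alpha> powr of_rat (g i)) *\<^sub>R axis i (x $ i)"
  let ?v = "\<Sum>i\<in>UNIV. (of_rat (g i) :: real) *\<^sub>R axis i (x $ i)"
  have sum_axis: "(\<Sum>i\<in>UNIV. r i *\<^sub>R axis i (x $ i)) = (\<chi> i. of_real (r i) * x $ i)" for r :: "'n \<Rightarrow> real"
  proof -
    have "(\<Sum>i\<in>UNIV. r i *\<^sub>R axis i (x $ i)) $ k = (\<Sum>i\<in>UNIV. if i = k then of_real (r k) * x $ k else 0)" for k
      unfolding sum_component by (intro sum.cong refl) (simp add: axis_def scaleR_conv_of_real[where 'a = complex])
    then show ?thesis by (simp add: vec_eq_iff)
  qed
  have \<gamma>: "?\<gamma> \<alpha> = wscale g \<alpha> x" for \<alpha>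
    unfolding sum_axis wscale_def ..
  have v: "?v = linear_field (weight_matrix g) 0 x"
    unfolding sum_axis by (simp add: vec_eq_iff linear_field_def weight_matrix_def diag_mat_mult_nth)
  have "(?\<gamma> has_vector_derivative ?v) (at 1)"
    by (rule has_vector_derivative_sum) (auto intro!: derivative_eq_intros)
  moreover have "(F has_derivative (\<lambda>v. dird v F x)) (at (?\<gamma> 1))"
    unfolding \<gamma> wscale_one by (rule mv_analytic_on_has_derivative[OF F x])
  ultimately have "(F \<circ> ?\<gamma> has_vector_derivative dird ?v F x) (at 1)"
    by (intro vector_derivative_diff_chain_within) (auto intro: has_derivative_at_withinI)
  moreover have "(F \<circ> ?\<gamma> has_vector_derivative complex_of_real w * F x) (at 1)"
  proof (rule has_vector_derivative_transform_within_open[where S = "{0<..}"])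
    show "((\<lambda>\<alpha>. (\<alpha> powr w) *\<^sub>R F x) has_vector_derivative complex_of_real w * F x) (at 1)"
      by (auto intro!: derivative_eq_intros simp: scaleR_conv_of_real)
    show "(\<alpha> powr w) *\<^sub>R F x = (F \<circ> ?\<gamma>) \<alpha>" if "\<alpha> \<in> {0<..}" for \<alpha>
      using hom[of \<alpha>] that unfolding o_def \<gamma> by (simp add: scaleR_conv_of_real)
  qed auto
  ultimately have "dird ?v F x = complex_of_real w * F x"
    by (rule vector_derivative_unique_at)
  then show ?thesis unfolding v vf_apply_eq_dird .
qed

text \<open>Finitely many rationals have a common denominator, for instance the product of
  individual ones, so the least number is attained.\<close>

lemma ramification_degree:
  fixes g :: "'n::finite \<Rightarrow> rat"
  shows "0 < ramification_degree g \<and> (\<forall>i. of_nat (ramification_degree g) * g i \<in> \<int>)"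
  unfolding ramification_degree_def
proof (rule LeastI_ex)
  have "\<exists>n>0. of_nat n * r \<in> \<int>" for r :: rat
  proof (cases r)
    case (Fract a b)
    then show ?thesis
      by (intro exI[of _ "nat b"]) (auto simp: Fract_of_int_quotient)
  qed
  then have "\<exists>n. \<forall>i. n i > 0 \<and> of_nat (n i) * g i \<in> \<int>" by (intro choice) blast
  then obtain n where n: "n i > 0" "of_nat (n i) * g i \<in> \<int>" for i by blast
  let ?l = "\<Prod>i\<in>UNIV. n i"
  have "of_nat ?l * g i \<in> \<int>" for i
  proof -
    have "of_nat ?l * g i = of_nat (\<Prod>j\<in>UNIV - {i}. n j) * (of_nat (n i) * g i)"
      by (subst prod.remove[of _ i]) (auto simp: mult_ac)
    then show ?thesis using n(2)[of i] by (metis Ints_mult Ints_of_nat)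
  qed
  moreover have "0 < ?l" using n(1) by (auto intro: prod_pos)
  ultimately show "\<exists>l>0. \<forall>i. of_nat l * g i \<in> \<int>" by blast
qed

text \<open>All monomials of the Taylor expansion of \<open>F\<close> at the origin have weight \<open>w\<close>.\<close>

lemma weight_is_sum_of_weights:
  fixes F :: "complex ^ 'n \<Rightarrow> complex"
  assumes U: "open U" "connected U" "0 \<in> U" and F: "mv_analytic_on F U" and x0: "x0 \<in> U" "F x0 \<noteq> 0"
    and hom: "\<And>\<alpha> x. \<alpha> > 0 \<Longrightarrow> x \<in> U \<Longrightarrow> F (wscale g \<alpha> x) = complex_of_real (\<alpha> powr w) * F x"
  shows "\<exists>js. w = sum_list (map (\<lambda>j. of_rat (g j)) js)"
proof -
  let ?L = "linear_field (weight_matrix g) 0" and ?e = "\<lambda>j. axis j 1 :: complex ^ 'n"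
  have span: "v = (\<Sum>j\<in>UNIV. v $ j *s ?e j)" for v
    by (simp add: basis_expansion)
  obtain us where "fold dird us F 0 \<noteq> 0"
    using vanishing_identity[OF U(1,2) F U(3) _ x0(1)] x0(2) by (auto simp: vanishes_to_def)
  then obtain js where js: "fold dird (map ?e js) F 0 \<noteq> 0"
    using fold_dird_spanning[OF U(1,3) F span, of us] by blast
  have eig: "weight_matrix g *v ?e j = of_rat (g j) *s ?e j" for j
    by (simp add: vec_eq_iff weight_matrix_def diag_mat_mult_nth axis_def)
  \<comment> \<open>The same derivative of the Euler operator applied to \<open>F\<close> is
    evaluated twice: by commuting coordinate directions through it, and by Euler's identity. The
    nonzero derivative then cancels.\<close>
  have "sum_list (map (\<lambda>j. of_rat (g j)) js) * fold dird (map ?e js) F 0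
      = fold dird (map ?e js) (vf_apply ?L F) 0"
    by (rule fold_dird_vf_apply_linear_field[OF U(1,3) F eig, symmetric])
  also have "\<dots> = fold dird (map ?e js) (\<lambda>x. complex_of_real w * F x) 0"
    using F hom by (intro fold_dird_cong[OF U(1,3)] euler_identity)
  also have "\<dots> = complex_of_real w * fold dird (map ?e js) F 0"
    by (rule fold_dird_cmult[OF U(1,3) F])
  finally have "sum_list (map (\<lambda>j. of_rat (g j)) js) = complex_of_real w"
    using js by simp
  also have "sum_list (map (\<lambda>j. of_rat (g j)) js) = complex_of_real (sum_list (map (\<lambda>j. of_rat (g j)) js))"
    by (induction js) auto
  finally show ?thesis by (metis of_real_eq_iff)
qed

text \<open>\<open>c\<close> may lie outside \<open>U\<close>, where analyticity is not assumed; the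
  scaling law transports the derivative from the point of \<open>U\<close>.\<close>

lemma dird_quasihomogeneous:
  fixes F :: "complex ^ 'n \<Rightarrow> complex"
  assumes U: "open U" and F: "mv_analytic_on F U" and \<beta>: "\<beta> > 0" "wscale g \<beta> c \<in> U"
    and hom: "\<And>x. wscale g \<beta> x \<in> U \<Longrightarrow> F (wscale g \<beta> x) = complex_of_real (\<beta> powr w) * F x"
  shows "dird (wscale g \<beta> v) F (wscale g \<beta> c) = complex_of_real (\<beta> powr w) * dird v F c"
proof -
  \<comment> \<open>On this neighbourhood of \<open>c\<close> the function \<open>F\<close> is
    \<open>?s\<close> times its pullback under \<open>wscale g \<beta>\<close>, so the chain rule
    applies.\<close>
  let ?V = "wscale g \<beta> -` U" and ?s = "complex_of_real (\<beta> powr - w)"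
  have V: "open ?V"
    by (rule open_vimage[OF U linear_continuous_on[OF bounded_linear_wscale]])
  have s: "?s * complex_of_real (\<beta> powr w) = 1"
    using \<beta>(1) by (simp flip: of_real_mult powr_add)
  have "(wscale g \<beta> has_derivative wscale g \<beta>) (at c)"
    by (rule bounded_linear_imp_has_derivative[OF bounded_linear_wscale])
  then have "(F \<circ> wscale g \<beta> has_derivative (\<lambda>v. dird v F (wscale g \<beta> c)) \<circ> wscale g \<beta>) (at c)"
    by (rule diff_chain_at) (rule mv_analytic_on_has_derivative[OF F \<beta>(2)])
  then have "((\<lambda>x. ?s * (F \<circ> wscale g \<beta>) x) has_derivative
      (\<lambda>v. ?s * ((\<lambda>v. dird v F (wscale g \<beta> c)) \<circ> wscale g \<beta>) v)) (at c)"
    by (rule has_derivative_mult_right)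
  then have "(F has_derivative (\<lambda>v. ?s * ((\<lambda>v. dird v F (wscale g \<beta> c)) \<circ> wscale g \<beta>) v)) (at c)"
  proof (rule has_derivative_transform_within_open)
    show "?s * (F \<circ> wscale g \<beta>) x = F x" if "x \<in> ?V" for x
      using s that by (simp add: hom mult.assoc[symmetric])
  qed (use V \<beta>(2) in auto)
  also have "(\<lambda>v. ?s * ((\<lambda>v. dird v F (wscale g \<beta> c)) \<circ> wscale g \<beta>) v) =
      (\<lambda>v. \<Sum>i\<in>UNIV. v $ i * (?s * complex_of_real (\<beta> powr of_rat (g i)) * partial i F (wscale g \<beta> c)))"
    by (simp add: fun_eq_iff dird_eq wscale_nth sum_distrib_left mult_ac)
  finally have "dird v F c = (\<Sum>i\<in>UNIV. v $ i * (?s * complex_of_real (\<beta> powr of_rat (g i)) * partial i F (wscale g \<beta> c)))"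
    by (rule has_derivative_imp_dird)
  also have "\<dots> = ?s * dird (wscale g \<beta> v) F (wscale g \<beta> c)"
    by (simp add: dird_eq wscale_nth sum_distrib_left mult_ac)
  finally show ?thesis using s by (simp add: mult.assoc[symmetric] mult.commute[of _ ?s])
qed

lemma jacobian_mult_nth: "(jacobian f x *v v) $ i = dird v (\<lambda>y. f y $ i) x"
  by (simp add: jacobian_def matrix_vector_mult_def dird_eq mult.commute)

subsection \<open>Resonances\<close>

text \<open>Turns a word of eigendirections into the multiplicities of the resonance
  condition.\<close>

lemma sum_count_list_mult:
  fixes f :: "'n::finite \<Rightarrow> complex"
  shows "(\<Sum>i\<in>UNIV. of_nat (count_list xs i) * f i) = sum_list (map f xs)"
proof (induction xs)
  case (Cons x xs)
  have "(\<Sum>i\<in>UNIV. of_nat (count_list (x # xs) i) * f i)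
      = (\<Sum>i\<in>UNIV. (if i = x then f x else 0) + of_nat (count_list xs i) * f i)"
    by (intro sum.cong) (auto simp: distrib_right)
  with Cons show ?case by (simp add: sum.distrib)
qed simp

text \<open>The index \<open>one\<close> stands for 1 in the resonance condition, and
  \<open>None\<close> for the additional index 0.\<close>

theorem theorem1:
  fixes f \<phi> :: "complex ^ 'n \<Rightarrow> complex ^ 'n"
    and g :: "'n \<Rightarrow> rat"
    and U :: "(complex ^ 'n) set"
    and c :: "complex ^ 'n"
    and lam :: "'n \<Rightarrow> complex"
    and one :: 'n
    and l :: nat
    and M :: real
  assumes "open U" and "connected U" and "0 \<in> U"
    and "analytic_field_on f U"
    and "quasihomogeneous_system g (saturation g U) f"
    and "l = ramification_degree g"
    and "c \<in> saturation g U" and "c \<noteq> 0"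
    and "f c + weight_matrix g *v c = 0"
    and "diagonalizable (kowalevskaya_matrix g f c)"
    and "eigenvalues_of (kowalevskaya_matrix g f c) lam"
    and "lam one = -1"
    and "analytic_field_on \<phi> U"
    and "lie_symmetry_of_degree g U f M \<phi>"
    and "\<exists>x\<in>U. \<phi> x \<noteq> 0"
    and "M \<ge> 0"
  shows "\<exists>j :: 'n option. \<exists>k :: 'n \<Rightarrow> nat.
           (\<Sum>i\<in>UNIV. of_nat (k i) * lam i)
             = of_nat l * (case j of None \<Rightarrow> 1 / of_nat l | Some i \<Rightarrow> lam i)
           \<and> real (k one) \<ge> M"
proof -
  let ?G = "weight_matrix g :: complex ^ 'n ^ 'n" and ?K = "kowalevskaya_matrix g f c"
  have l: "l > 0" "of_nat l * g i \<in> \<int>" for i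
    using ramification_degree[of g] assms(6) by auto
  have fi: "mv_analytic_on (\<lambda>x. f x $ i) U" and \<phi>i: "mv_analytic_on (\<lambda>x. \<phi> x $ i) U" for i
    using assms(4,13) by (auto simp: analytic_field_on_def)
  have f_hom: "f (wscale g \<alpha> x) $ i = complex_of_real (\<alpha> powr (of_rat (g i) + 1)) * f x $ i"
    if "\<alpha> > 0" "x \<in> saturation g U" for \<alpha> x i
    using assms(5) that by (auto simp: quasihomogeneous_system_def)
  have sat: "x \<in> saturation g U" if "x \<in> U" for x
    using that by (auto simp: saturation_def wscale_one intro!: exI[of _ 1])
  define w where "w i = M / real l + of_rat (g i)" for i
  have \<phi>_hom: "\<phi> (wscale g \<alpha> x) $ i = complex_of_real (\<alpha> powr w i) * \<phi> x $ i"
    if "\<alpha> > 0" "x \<in> U" for \<alpha> x i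
    using assms(14) that l(1) sat[OF that(2)]
    by (simp add: lie_symmetry_of_degree_def quasihomogeneous_fun_def w_def assms(6)[symmetric] add_divide_distrib)
  obtain x0 where x0: "x0 \<in> U" "\<phi> x0 \<noteq> 0" using assms(15) by blast
  obtain N :: nat where N: "M = of_nat N"
  proof -
    obtain i where i: "\<phi> x0 $ i \<noteq> 0" using x0(2) by (auto simp: vec_eq_iff)
    obtain js where js: "w i = sum_list (map (\<lambda>j. of_rat (g j)) js)"
      using weight_is_sum_of_weights[OF assms(1-3) \<phi>i x0(1) i \<phi>_hom] by blast
    \<comment> \<open>Since \<open>w i\<close> is a sum of weights, this exhibits \<open>M\<close>
      as an integral combination of the integers \<open>l * g j\<close>.\<close>
    have "M = real l * w i - real l * of_rat (g i)"
      using l(1) by (simp add: w_def field_simps)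
    also have "\<dots> = of_rat (sum_list (map (\<lambda>j. of_nat l * g j) js) - of_nat l * g i)"
      unfolding js by (induction js) (auto simp: of_rat_add of_rat_diff of_rat_minus of_rat_mult algebra_simps)
    finally have "M = of_rat (sum_list (map (\<lambda>j. of_nat l * g j) js) - of_nat l * g i)" .
    moreover have "sum_list (map (\<lambda>j. of_nat l * g j) js) - of_nat l * g i \<in> \<int>"
      using l(2) by (induction js) (auto simp: add_diff_eq[symmetric])
    ultimately obtain z :: int where "M = of_int z" by (auto elim!: Ints_cases)
    with assms(16) have "M = of_nat (nat z)" by simp
    then show ?thesis by (rule that)
  qed
  obtain \<beta> where \<beta>: "\<beta> > 0" "wscale g \<beta> c \<in> U"
    using assms(7) by (auto simp: saturation_def)
  define c' where "c' = wscale g \<beta> c"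
  \<comment> \<open>Quasihomogeneity and \<open>f c = - G c\<close> give
    \<open>f c' = - \<beta> G c'\<close>, so the factor \<beta> is what makes \<open>c'\<close> a
    zero of \<open>h\<close>.\<close>
  define h where "h x = f x + complex_of_real \<beta> *s (?G *v x)" for x
  have G_nth: "(?G *v x) $ i = of_rat (g i) * x $ i" for x i
    by (simp add: weight_matrix_def diag_mat_mult_nth)
  have h_nth: "h x $ i = f x $ i + (of_real \<beta> * of_rat (g i)) * x $ i" for x i
    by (simp add: h_def G_nth mult.assoc)
  have hi: "mv_analytic_on (\<lambda>x. h x $ i) U" for i
    unfolding h_nth by (intro mv_analytic_intros fi)
  have dird_h: "dird v (\<lambda>x. h x $ i) x = dird v (\<lambda>x. f x $ i) x + of_real \<beta> * of_rat (g i) * v $ i"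
    if "x \<in> U" for v x i
    unfolding h_nth using that fi[of i]
    by (simp add: dird_add[of _ U] dird_cmult[of _ U] mv_analytic_intros dird_coord)
  have powr1: "complex_of_real (\<beta> powr (r + 1)) = of_real \<beta> * of_real (\<beta> powr r)" for r
    using \<beta>(1) by (simp add: powr_add)
  \<comment> \<open>Differentiating quasihomogeneity at \<open>c\<close>, and using that
    \<open>wscale g \<beta>\<close> commutes with the diagonal matrix \<open>?G\<close>, shows that
    the Jacobian of \<open>h\<close> at \<open>c'\<close> is conjugate to \<beta> times
    \<open>?K\<close>.\<close>
  have jac: "jacobian h c' *v wscale g \<beta> v = of_real \<beta> *s wscale g \<beta> (?K *v v)" for v
  proof -
    have "(jacobian h c' *v wscale g \<beta> v) $ i = (of_real \<beta> *s wscale g \<beta> (?K *v v)) $ i" for i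
    proof -
      have "dird (wscale g \<beta> v) (\<lambda>x. f x $ i) c'
          = complex_of_real (\<beta> powr (of_rat (g i) + 1)) * dird v (\<lambda>x. f x $ i) c"
        unfolding c'_def using \<beta>
        by (intro dird_quasihomogeneous[OF assms(1) fi \<beta>] f_hom) (auto simp: saturation_def)
      then show ?thesis
        unfolding powr1
        using \<beta> by (simp add: jacobian_mult_nth dird_h c'_def wscale_nth kowalevskaya_matrix_def
            matrix_vector_mult_add_rdistrib G_nth algebra_simps)
    qed
    then show ?thesis by (simp add: vec_eq_iff)
  qed
  obtain p :: "'n \<Rightarrow> complex ^ 'n" and d q where p: "\<And>j. p j \<noteq> 0" "\<And>j. ?K *v p j = d j *s p j"
    and span: "\<And>v. v = (\<Sum>j\<in>UNIV. q v j *s p j)"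
    by (rule diagonalizable_eigenbasis[OF assms(10)]) (rule that)
  have "\<exists>js W. W \<noteq> 0 \<and> jacobian h c' *v W
      = (sum_list (map (\<lambda>j. of_real \<beta> * d j) js) - of_real (\<beta> * M / l)) *s W"
  proof (rule lowest_order_eigenvector[OF assms(1,2) _ _ _ assms(13) x0])
    show "c' \<in> U" using \<beta> by (simp add: c'_def)
    show "analytic_field_on h U" by (simp add: analytic_field_on_def hi)
    show "h c' = 0"
    proof -
      have "f c $ i = - (of_rat (g i) * c $ i)" for i
        using assms(9) by (metis G_nth add_eq_0_iff2 vector_uminus_component)
      then show ?thesis
        using \<beta>(1) assms(7) by (simp add: vec_eq_iff h_nth c'_def f_hom powr1 wscale_nth)
    qed
    show "vf_apply h (\<lambda>y. \<phi> y $ i) x - vf_apply \<phi> (\<lambda>y. h y $ i) x = of_real (\<beta> * M / l) * \<phi> x $ i"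
      if x: "x \<in> U" for x i
    proof -
      \<comment> \<open>Testing the commutator on coordinate functions yields its
        components.\<close>
      have coord: "vf_apply X (\<lambda>y. y $ i) = (\<lambda>x. X x $ i)" for X :: "complex ^ 'n \<Rightarrow> complex ^ 'n"
        by (simp add: fun_eq_iff vf_apply_eq_dird dird_coord)
      have "lie_symmetry U f \<phi>"
        using assms(14) by (simp add: lie_symmetry_of_degree_def)
      then have "vf_apply f (vf_apply \<phi> (\<lambda>y. y $ i)) x - vf_apply \<phi> (vf_apply f (\<lambda>y. y $ i)) x = 0"
        using x mv_analytic_on_coord[of i U] unfolding lie_symmetry_def by blast
      then have "vf_apply f (\<lambda>y. \<phi> y $ i) x - vf_apply \<phi> (\<lambda>y. f y $ i) x = 0"
        unfolding coord .
      moreover have "dird (?G *v x) (\<lambda>y. \<phi> y $ i) x = of_real (w i) * \<phi> x $ i"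
        using euler_identity[OF \<phi>i x \<phi>_hom[OF _ x]] by (simp add: vf_apply_eq_dird linear_field_def)
      \<comment> \<open>The added linear term contributes \<beta> \<open>w i\<close> minus \<beta>
        \<open>g i\<close> times the component of \<phi>, which leaves the factor \<beta>
        \<open>M / l\<close>.\<close>
      ultimately show ?thesis
        unfolding vf_apply_eq_dird dird_h[OF x] h_def[of x]
        by (simp add: dird_vec_add dird_vec_scale w_def algebra_simps)
    qed
    show "jacobian h c' *v wscale g \<beta> (p j) = (of_real \<beta> * d j) *s wscale g \<beta> (p j)" for j
      by (simp add: jac p(2) wscale_scale)
    show "v = (\<Sum>j\<in>UNIV. q (wscale g (inverse \<beta>) v) j *s wscale g \<beta> (p j))" for v
      using arg_cong[OF span[of "wscale g (inverse \<beta>) v"], of "wscale g \<beta>"] \<beta>(1)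
      by (simp add: wscale_inverse wscale_sum wscale_scale)
  qed
  then obtain js W where W: "W \<noteq> 0" and W_eig: "jacobian h c' *v W
      = (sum_list (map (\<lambda>j. of_real \<beta> * d j) js) - of_real (\<beta> * M / l)) *s W" by blast
  \<comment> \<open>The eigenvalue of \<open>?K\<close> left after dividing by \<beta>;
    \<open>u\<close> is the matching eigenvector, moved back from \<open>c'\<close> to
    \<open>c\<close>.\<close>
  define e where "e = sum_list (map d js) - of_real (M / l)"
  define u where "u = wscale g (inverse \<beta>) W"
  have Wu: "W = wscale g \<beta> u" using \<beta>(1) by (simp add: u_def wscale_inverse)
  then have "u \<noteq> 0" using W by (auto simp: wscale_zero)
  have "of_real \<beta> *s wscale g \<beta> (?K *v u) = (of_real \<beta> * e) *s wscale g \<beta> u"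
    using W_eig unfolding Wu jac e_def by (simp add: sum_list_const_mult right_diff_distrib)
  then have "wscale g \<beta> (?K *v u) = wscale g \<beta> (e *s u)"
    using \<beta>(1) by (simp add: vec_eq_iff wscale_nth)
  then have "?K *v u = e *s u"
    using \<beta>(1) by (metis wscale_inverse')
  then obtain j where j: "e = lam j"
    using eigenvalue_in_eigenvalues_of[OF assms(11)] \<open>u \<noteq> 0\<close> by blast
  have "\<exists>i. d j = lam i" for j
    using eigenvalue_in_eigenvalues_of[OF assms(11) p(2) p(1)] .
  then obtain \<sigma> where \<sigma>: "d j = lam (\<sigma> j)" for j by metis
  \<comment> \<open>Multiplying \<open>sum_list (map d js) - M / l = lam j\<close> by
    \<open>l\<close> repeats every eigenvalue of the word \<open>l\<close> times. The term
    \<open>- N\<close> becomes \<open>N\<close> further copies of \<open>lam one = -1\<close>, which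
    also forces \<open>k one\<close> to be at least \<open>M\<close>.\<close>
  define k where "k i = l * count_list (map \<sigma> js) i + (if i = one then N else 0)" for i
  have "(\<Sum>i\<in>UNIV. of_nat (k i) * lam i)
      = (\<Sum>i\<in>UNIV. of_nat l * (of_nat (count_list (map \<sigma> js) i) * lam i) + (if i = one then of_nat N * lam one else 0))"
    by (intro sum.cong) (auto simp: k_def algebra_simps)
  also have "\<dots> = of_nat l * sum_list (map lam (map \<sigma> js)) - of_nat N"
    by (simp add: sum.distrib assms(12) sum_count_list_mult flip: sum_distrib_left)
  also have "sum_list (map lam (map \<sigma> js)) = sum_list (map d js)"
    by (simp add: o_def flip: \<sigma>)
  also have "of_nat l * sum_list (map d js) - of_nat N = of_nat l * lam j"
    using l(1) by (simp add: j[symmetric] e_def N field_simps)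
  finally have "(\<Sum>i\<in>UNIV. of_nat (k i) * lam i) = of_nat l * (case Some j of None \<Rightarrow> 1 / of_nat l | Some i \<Rightarrow> lam i)"
    by simp
  moreover have "real (k one) \<ge> M" by (simp add: k_def N)
  ultimately show ?thesis by blast
qed

end
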